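(* Let $(T_1,T_2,T_3)$ be an associative Clifford extension over $(V,S^0,S^1)$ with $T_1\ne0$. (a) If $\dim V=1$, then there exist a nonzero Euclidean space $\tilde V$ and a $\mathrm{Cl}(\tilde V)$-module $\tilde S^0\oplus\tilde S^1$ such that $(V,S^0,S^1,T_1,T_2,T_3)$ is isomorphic to $(\mathbb R,\tilde V,\tilde V,\tilde S^0,\tilde S^1,\tilde S^1)$, where $\mathbb R$ acts on $\tilde V\oplus\tilde V$ and on $\tilde S^1\oplus\tilde S^1$ by $a\cdot(x,y)=(-ay,ax)$, and both copies of $\tilde V$ act on $\tilde S^0\oplus\tilde S^1$ by the given Clifford action. (b) If $\dim V>1$ and $\dim S^0=2$, then the extension is isomorphic to the model $\mathcal E(\mathbb C,\mathbb C,n)$ for some $n\ge1$. (c) If $\dim V>1$ and $\dim S^0>2$, then the extension is isomorphic to the model $\mathcal E(W,\mathbb H,n)$ for some $n\ge1$ and some real subspace $W\subset\mathbb H$ with $\dim W=\dim V$.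
   Context: All spaces are finite-dimensional real Euclidean. For a Euclidean space $X$, $\mathrm{Cl}(X)$ is the Clifford algebra with $x\cdot x=-|x|^2$; a "$\mathrm{Cl}(X)$-module $Y\oplus Z$" is a $\mathbb Z/2$-graded module with $X\cdot Y\subset Z$, $X\cdot Z\subset Y$, $Y\perp Z$, each $x\in X$ acting skew-symmetrically; the action is written $xy$. Let $V\neq0$ be Euclidean and $S^0\oplus S^1$ a nonzero $\mathrm{Cl}(V)$-module. A Clifford extension over $(V,S^0,S^1)$ is a triple of Euclidean spaces $T_1,T_2,T_3$ of equal dimension together with a $\mathrm{Cl}(V)$-module structure on $T_2\oplus T_3$, a $\mathrm{Cl}(S^0)$-module structure on $T_1\oplus T_2$, and a $\mathrm{Cl}(S^1)$-module structure on $T_1\oplus T_3$. It is associative if $(vs^0)t_1=v(s^0t_1)$ for all $v\in V,s^0\in S^0,t_1\in T_1$. An isomorphism of two such data $(V,S^0,S^1,T_1,T_2,T_3)$ is a family of linear isometries of the six spaces intertwining all four Clifford actions. Model extension $\mathcal E(W,\mathbb A,n)$ for $\mathbb A\in\{\mathbb C,\mathbb H\}$, a nonzero real subspace $W\subset\mathbb A$ and $n\ge1$: $V=W$, $S^0=S^1=\mathbb A$, $T_1=T_2=T_3=\mathbb A^n$ (metric $\mathrm{Re}\sum x_i\bar y_i$); for each of the four pairs (acting space $X$, module $Y\oplus Z$) $=(W,S^0\oplus S^1)$, $(S^0,T_1\oplus T_2)$, $(S^1,T_1\oplus T_3)$, $(W,T_2\oplus T_3)$, the action is $x\cdot y=xy$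 for $y\in Y$ and $x\cdot z=-\bar x z$ for $z\in Z$ (left multiplication in $\mathbb A$, coordinatewise on $\mathbb A^n$). *)

theory Defs
  imports "HOL-Analysis.Analysis" "HOL-Library.Function_Algebras"
begin

instantiation "fun" :: (type, real_vector) real_vector
begin
definition scaleR_fun :: "real \<Rightarrow> ('a \<Rightarrow> 'b) \<Rightarrow> 'a \<Rightarrow> 'b"
  where "scaleR_fun r f = (\<lambda>x. r *\<^sub>R f x)"
instance
  by standard (simp_all add: scaleR_fun_def fun_eq_iff scaleR_add_right scaleR_add_left)
end

definition lin_on :: "'a::real_vector set \<Rightarrow> ('a \<Rightarrow> 'b::real_vector) \<Rightarrow> bool" where
  "lin_on U f \<longleftrightarrow> (\<forall>x\<in>U. \<forall>y\<in>U. \<forall>r. f (r *\<^sub>R x + y) = r *\<^sub>R f x + f y)"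

definition euclid :: "'a::real_vector set \<Rightarrow> ('a \<Rightarrow> 'a \<Rightarrow> real) \<Rightarrow> bool" where
  "euclid U ip \<longleftrightarrow> subspace U \<and> (\<exists>B. finite B \<and> B \<subseteq> U \<and> span B = U)
     \<and> (\<forall>x\<in>U. \<forall>y\<in>U. ip x y = ip y x)
     \<and> (\<forall>z\<in>U. lin_on U (\<lambda>x. ip x z))
     \<and> (\<forall>x\<in>U. x \<noteq> 0 \<longrightarrow> ip x x > 0)"

definition isometry :: "'a::real_vector set \<Rightarrow> ('a \<Rightarrow> 'a \<Rightarrow> real) \<Rightarrow>
    'b::real_vector set \<Rightarrow> ('b \<Rightarrow> 'b \<Rightarrow> real) \<Rightarrow> ('a \<Rightarrow> 'b) \<Rightarrow> bool" where
  "isometry U g W h f \<longleftrightarrow> bij_betw f U W \<and> lin_on U f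
     \<and> (\<forall>x\<in>U. \<forall>y\<in>U. h (f x) (f y) = g x y)"

text \<open>A Cl(X)-module structure on the Z/2-graded space Y (+) Z (orthogonal direct
 sum): the action of x on Y is m x :: Y -> Z and on Z is m' x :: Z -> Y.  The action
 is linear in x (so it is given by a linear map X -> End(Y (+) Z)), satisfies the
 Clifford relation x.(x.w) = -|x|^2 w, and each x acts skew-symmetrically on
 Y (+) Z.  By the universal property of Cl(X) this is exactly a graded
 Cl(X)-module structure.\<close>
definition clmod :: "'x::real_vector set \<Rightarrow> ('x \<Rightarrow> 'x \<Rightarrow> real) \<Rightarrow>
    'y::real_vector set \<Rightarrow> ('y \<Rightarrow> 'y \<Rightarrow> real) \<Rightarrow>
    'z::real_vector set \<Rightarrow> ('z \<Rightarrow> 'z \<Rightarrow> real) \<Rightarrow>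
    ('x \<Rightarrow> 'y \<Rightarrow> 'z) \<Rightarrow> ('x \<Rightarrow> 'z \<Rightarrow> 'y) \<Rightarrow> bool" where
  "clmod X gX Y gY Z gZ m m' \<longleftrightarrow>
     euclid X gX \<and> euclid Y gY \<and> euclid Z gZ
     \<and> (\<forall>x\<in>X. \<forall>y\<in>Y. m x y \<in> Z) \<and> (\<forall>x\<in>X. \<forall>z\<in>Z. m' x z \<in> Y)
     \<and> (\<forall>x\<in>X. lin_on Y (m x) \<and> lin_on Z (m' x))
     \<and> (\<forall>y\<in>Y. lin_on X (\<lambda>x. m x y)) \<and> (\<forall>z\<in>Z. lin_on X (\<lambda>x. m' x z))
     \<and> (\<forall>x\<in>X. \<forall>y\<in>Y. m' x (m x y) = - (gX x x *\<^sub>R y))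
     \<and> (\<forall>x\<in>X. \<forall>z\<in>Z. m x (m' x z) = - (gX x x *\<^sub>R z))
     \<and> (\<forall>x\<in>X. \<forall>y\<in>Y. \<forall>z\<in>Z. gZ (m x y) z = - gY y (m' x z))"

record ('v,'s,'r,'t,'u,'w) cdata =
  cV :: "'v set"   gV :: "'v \<Rightarrow> 'v \<Rightarrow> real"
  cS0 :: "'s set"  gS0 :: "'s \<Rightarrow> 's \<Rightarrow> real"
  cS1 :: "'r set"  gS1 :: "'r \<Rightarrow> 'r \<Rightarrow> real"
  cT1 :: "'t set"  gT1 :: "'t \<Rightarrow> 't \<Rightarrow> real"
  cT2 :: "'u set"  gT2 :: "'u \<Rightarrow> 'u \<Rightarrow> real"
  cT3 :: "'w set"  gT3 :: "'w \<Rightarrow> 'w \<Rightarrow> real"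
  actVS0 :: "'v \<Rightarrow> 's \<Rightarrow> 'r"  actVS1 :: "'v \<Rightarrow> 'r \<Rightarrow> 's"
  actS0T1 :: "'s \<Rightarrow> 't \<Rightarrow> 'u"  actS0T2 :: "'s \<Rightarrow> 'u \<Rightarrow> 't"
  actS1T1 :: "'r \<Rightarrow> 't \<Rightarrow> 'w"  actS1T3 :: "'r \<Rightarrow> 'w \<Rightarrow> 't"
  actVT2 :: "'v \<Rightarrow> 'u \<Rightarrow> 'w"  actVT3 :: "'v \<Rightarrow> 'w \<Rightarrow> 'u"

definition clifford_extension ::
  "('v::real_vector,'s::real_vector,'r::real_vector,'t::real_vector,'u::real_vector,'w::real_vector) cdata \<Rightarrow> bool" where
  "clifford_extension E \<longleftrightarrow>
     cV E \<noteq> {0}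
   \<and> clmod (cV E) (gV E) (cS0 E) (gS0 E) (cS1 E) (gS1 E) (actVS0 E) (actVS1 E)
   \<and> ((\<exists>s\<in>cS0 E. s \<noteq> 0) \<or> (\<exists>s\<in>cS1 E. s \<noteq> 0))
   \<and> euclid (cT1 E) (gT1 E) \<and> euclid (cT2 E) (gT2 E) \<and> euclid (cT3 E) (gT3 E)
   \<and> dim (cT1 E) = dim (cT2 E) \<and> dim (cT2 E) = dim (cT3 E)
   \<and> clmod (cV E) (gV E) (cT2 E) (gT2 E) (cT3 E) (gT3 E) (actVT2 E) (actVT3 E)
   \<and> clmod (cS0 E) (gS0 E) (cT1 E) (gT1 E) (cT2 E) (gT2 E) (actS0T1 E) (actS0T2 E)
   \<and> clmod (cS1 E) (gS1 E) (cT1 E) (gT1 E) (cT3 E) (gT3 E) (actS1T1 E) (actS1T3 E)"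

definition associative_ext :: "('v,'s,'r,'t,'u,'w) cdata \<Rightarrow> bool" where
  "associative_ext E \<longleftrightarrow>
     (\<forall>v\<in>cV E. \<forall>s\<in>cS0 E. \<forall>t\<in>cT1 E.
        actS1T1 E (actVS0 E v s) t = actVT2 E v (actS0T1 E s t))"

definition cdata_iso ::
  "('v::real_vector,'s::real_vector,'r::real_vector,'t::real_vector,'u::real_vector,'w::real_vector) cdata \<Rightarrow>
   ('v2::real_vector,'s2::real_vector,'r2::real_vector,'t2::real_vector,'u2::real_vector,'w2::real_vector) cdata \<Rightarrow> bool" where
  "cdata_iso E F \<longleftrightarrow> (\<exists>fV fS0 fS1 fT1 fT2 fT3.
      isometry (cV E) (gV E) (cV F) (gV F) fV
    \<and> isometry (cS0 E) (gS0 E) (cS0 F) (gS0 F) fS0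
    \<and> isometry (cS1 E) (gS1 E) (cS1 F) (gS1 F) fS1
    \<and> isometry (cT1 E) (gT1 E) (cT1 F) (gT1 F) fT1
    \<and> isometry (cT2 E) (gT2 E) (cT2 F) (gT2 F) fT2
    \<and> isometry (cT3 E) (gT3 E) (cT3 F) (gT3 F) fT3
    \<and> (\<forall>v\<in>cV E. \<forall>s\<in>cS0 E. fS1 (actVS0 E v s) = actVS0 F (fV v) (fS0 s))
    \<and> (\<forall>v\<in>cV E. \<forall>s\<in>cS1 E. fS0 (actVS1 E v s) = actVS1 F (fV v) (fS1 s))
    \<and> (\<forall>s\<in>cS0 E. \<forall>t\<in>cT1 E. fT2 (actS0T1 E s t) = actS0T1 F (fS0 s) (fT1 t))
    \<and> (\<forall>s\<in>cS0 E. \<forall>t\<in>cT2 E. fT1 (actS0T2 E s t) = actS0T2 F (fS0 s) (fT2 t))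
    \<and> (\<forall>s\<in>cS1 E. \<forall>t\<in>cT1 E. fT3 (actS1T1 E s t) = actS1T1 F (fS1 s) (fT1 t))
    \<and> (\<forall>s\<in>cS1 E. \<forall>t\<in>cT3 E. fT1 (actS1T3 E s t) = actS1T3 F (fS1 s) (fT3 t))
    \<and> (\<forall>v\<in>cV E. \<forall>t\<in>cT2 E. fT3 (actVT2 E v t) = actVT2 F (fV v) (fT2 t))
    \<and> (\<forall>v\<in>cV E. \<forall>t\<in>cT3 E. fT2 (actVT3 E v t) = actVT3 F (fV v) (fT3 t)))"

definition real_line_data ::
  "'a set \<Rightarrow> ('a \<Rightarrow> 'a \<Rightarrow> real) \<Rightarrow> 'b set \<Rightarrow> ('b \<Rightarrow> 'b \<Rightarrow> real) \<Rightarrow>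
   'c set \<Rightarrow> ('c \<Rightarrow> 'c \<Rightarrow> real) \<Rightarrow> ('a \<Rightarrow> 'b \<Rightarrow> 'c) \<Rightarrow> ('a \<Rightarrow> 'c \<Rightarrow> 'b) \<Rightarrow>
   (real, 'a::real_vector, 'a, 'b::real_vector, 'c::real_vector, 'c) cdata" where
  "real_line_data Vt gVt St0 g0 St1 g1 m m' =
    \<lparr> cV = UNIV, gV = (\<lambda>a b. a * b),
      cS0 = Vt, gS0 = gVt, cS1 = Vt, gS1 = gVt,
      cT1 = St0, gT1 = g0, cT2 = St1, gT2 = g1, cT3 = St1, gT3 = g1,
      actVS0 = (\<lambda>a x. a *\<^sub>R x), actVS1 = (\<lambda>a y. - (a *\<^sub>R y)),
      actS0T1 = m, actS0T2 = m', actS1T1 = m, actS1T3 = m',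
      actVT2 = (\<lambda>a x. a *\<^sub>R x), actVT3 = (\<lambda>a y. - (a *\<^sub>R y)) \<rparr>"

type_synonym quat = "real ^ 4"

definition qmult :: "quat \<Rightarrow> quat \<Rightarrow> quat" where
  "qmult p q = vector
     [ p$1 * q$1 - p$2 * q$2 - p$3 * q$3 - p$4 * q$4,
       p$1 * q$2 + p$2 * q$1 + p$3 * q$4 - p$4 * q$3,
       p$1 * q$3 - p$2 * q$4 + p$3 * q$1 + p$4 * q$2,
       p$1 * q$4 + p$2 * q$3 - p$3 * q$2 + p$4 * q$1 ]"

definition qcnj :: "quat \<Rightarrow> quat" where
  "qcnj p = vector [p$1, - p$2, - p$3, - p$4]"

definition qre :: "quat \<Rightarrow> real" where
  "qre p = p$1"

text \<open>A^n as the functions nat => A vanishing at indices >= n.\<close>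
definition An :: "nat \<Rightarrow> (nat \<Rightarrow> 'a::zero) set" where
  "An n = {f. \<forall>i\<ge>n. f i = 0}"

definition model_ext ::
  "('a \<Rightarrow> 'a \<Rightarrow> 'a) \<Rightarrow> ('a \<Rightarrow> 'a) \<Rightarrow> ('a \<Rightarrow> real) \<Rightarrow> 'a set \<Rightarrow> nat \<Rightarrow>
   ('a::real_vector, 'a, 'a, nat \<Rightarrow> 'a, nat \<Rightarrow> 'a, nat \<Rightarrow> 'a) cdata" where
  "model_ext mul cj re W n =
    (let gA = (\<lambda>x y. re (mul x (cj y)));
         gN = (\<lambda>f g. re (\<Sum>i<n. mul (f i) (cj (g i))));
         l = (\<lambda>x y. mul x y);
         r = (\<lambda>x z. - mul (cj x) z);
         lN = (\<lambda>x f. (\<lambda>i. mul x (f i)));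
         rN = (\<lambda>x f. (\<lambda>i. - mul (cj x) (f i)))
     in \<lparr> cV = W, gV = gA, cS0 = UNIV, gS0 = gA, cS1 = UNIV, gS1 = gA,
          cT1 = An n, gT1 = gN, cT2 = An n, gT2 = gN, cT3 = An n, gT3 = gN,
          actVS0 = l, actVS1 = r, actS0T1 = lN, actS0T2 = rN,
          actS1T1 = lN, actS1T3 = rN, actVT2 = lN, actVT3 = rN \<rparr>)"

abbreviation model_C :: "complex set \<Rightarrow> nat \<Rightarrow> _" where
  "model_C W n \<equiv> model_ext (*) cnj Re W n"

abbreviation model_H :: "quat set \<Rightarrow> nat \<Rightarrow> _" where
  "model_H W n \<equiv> model_ext qmult qcnj qre W n"

end

(* Fix unit vectors v in V and s in S^0.  Acting with v identifies S^1 with S^0 and T_3 with T_2,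
   acting with s identifies T_2 with T_1.  Every vector of S^0 then becomes an endomorphism of T_1,
   vectors orthogonal to s act as anticommuting complex structures, and every vector of V becomes
   an endomorphism of S^0.  If e in V is a unit vector orthogonal to v, put i = e s; for any
   j in S^0, associativity says that e j acts on T_1 as the composition of i and j.  Hence s, i, j
   and k = e j satisfy the quaternion relations, and a unit vector orthogonal to all four would
   anticommute with i and j but also with their product k, which is impossible on T_1 /= 0.
   So S^0 is C or H, its action turns T_1 into a module over it, a maximal orthonormal
   family over the algebra identifies T_1 with A^n, and V is recovered as the subspace V s. *)

theory Submission
  imports Defs
begin

section \<open>Euclidean subspaces\<close>

text \<open>S^0 has no product of its own, so the multiplication rule is stated for endomorphisms of
  T_1. It comes back to the spinor spaces, as an identity in S^1, because a nonzero vector acts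
  injectively and T_1 contains some t /= 0. The endomorphism that x gives relative to a unit vector
  u is u^{-1} x, and u^{-1} = -u is the sign in \<open>rot\<close>. A vector w of V corresponds to
  the q in A with w s = v q. Hence W always contains 1, the image of v, but it may be a proper
  subspace of H. Isomorphisms are built from the model into the extension, where explicit formulas
  such as c -> sum of c_p t_p are available, and are inverted at the end. Only the four even actions
  then have to be compared. In case (a) the witnesses must live in one fixed type, which is why
  abstract spaces are first moved into functions on \<open>nat\<close>.\<close>

lemma lin_onI:
  assumes "\<And>x y. x \<in> U \<Longrightarrow> y \<in> U \<Longrightarrow> f (x + y) = f x + f y"
    and "\<And>r x. x \<in> U \<Longrightarrow> f (r *\<^sub>R x) = r *\<^sub>R f x" and "subspace U"
  shows "lin_on U f"
  using assms by (auto simp: lin_on_def subspace_scale)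

lemma lin_on_add: "lin_on U f \<Longrightarrow> x \<in> U \<Longrightarrow> y \<in> U \<Longrightarrow> f (x + y) = f x + f y"
  unfolding lin_on_def by (metis scaleR_one)

lemma lin_on_zero:
  assumes "lin_on U f" "subspace U" shows "f 0 = 0"
  using lin_on_add[OF assms(1) subspace_0[OF assms(2)] subspace_0[OF assms(2)]] by simp

lemma lin_on_scale:
  assumes "lin_on U f" "subspace U" "x \<in> U" shows "f (r *\<^sub>R x) = r *\<^sub>R f x"
proof -
  have "f (r *\<^sub>R x + 0) = r *\<^sub>R f x + f 0"
    using assms subspace_0 unfolding lin_on_def by blast
  then show ?thesis using lin_on_zero[OF assms(1,2)] by simp
qed

lemma lin_on_minus:
  "lin_on U f \<Longrightarrow> subspace U \<Longrightarrow> x \<in> U \<Longrightarrow> f (- x) = - f x"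
  using lin_on_scale[of U f x "-1"] by simp

lemma lin_on_diff:
  "lin_on U f \<Longrightarrow> subspace U \<Longrightarrow> x \<in> U \<Longrightarrow> y \<in> U \<Longrightarrow> f (x - y) = f x - f y"
  using lin_on_add[of U f x "- y"] lin_on_minus[of U f y] subspace_neg[of U y] by simp

lemma lin_on_sum:
  assumes "lin_on U f" "subspace U" "\<And>i. i \<in> I \<Longrightarrow> h i \<in> U"
  shows "f (\<Sum>i\<in>I. h i) = (\<Sum>i\<in>I. f (h i))"
  using assms(3)
proof (induction I rule: infinite_finite_induct)
  case (insert i I)
  then have "(\<Sum>i\<in>I. h i) \<in> U" by (intro subspace_sum[OF assms(2)]) auto
  with insert show ?case by (simp add: lin_on_add[OF assms(1)])
qed (use lin_on_zero[OF assms(1,2)] in auto)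

section \<open>Orthonormal families in a Euclidean carrier\<close>

definition orthonormal :: "('a \<Rightarrow> 'a \<Rightarrow> real) \<Rightarrow> 'a set \<Rightarrow> bool" where
  "orthonormal g B \<longleftrightarrow> (\<forall>b\<in>B. \<forall>c\<in>B. g b c = (if b = c then 1 else 0))"

locale euclid_sp =
  fixes U :: "'a::real_vector set" and g :: "'a \<Rightarrow> 'a \<Rightarrow> real"
  assumes euclid: "euclid U g"
begin

lemma sub: "subspace U"
  using euclid by (simp add: euclid_def)

lemma closed [simp]:
  "0 \<in> U" "x \<in> U \<Longrightarrow> y \<in> U \<Longrightarrow> x + y \<in> U" "x \<in> U \<Longrightarrow> r *\<^sub>R x \<in> U"
  "x \<in> U \<Longrightarrow> - x \<in> U" "x \<in> U \<Longrightarrow> y \<in> U \<Longrightarrow> x - y \<in> U"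
  using sub by (auto simp: subspace_0 subspace_add subspace_scale subspace_neg subspace_diff)

lemma sum_closed: "(\<And>i. i \<in> I \<Longrightarrow> h i \<in> U) \<Longrightarrow> (\<Sum>i\<in>I. h i) \<in> U"
  by (rule subspace_sum[OF sub])

lemma sym: "x \<in> U \<Longrightarrow> y \<in> U \<Longrightarrow> g x y = g y x"
  using euclid by (simp add: euclid_def)

lemma lin: "z \<in> U \<Longrightarrow> lin_on U (\<lambda>x. g x z)"
  using euclid by (simp add: euclid_def)

lemma pos: "x \<in> U \<Longrightarrow> x \<noteq> 0 \<Longrightarrow> g x x > 0"
  using euclid by (simp add: euclid_def)

lemma left:
  assumes "z \<in> U"
  shows "x \<in> U \<Longrightarrow> y \<in> U \<Longrightarrow> g (x + y) z = g x z + g y z"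
    and "x \<in> U \<Longrightarrow> y \<in> U \<Longrightarrow> g (x - y) z = g x z - g y z"
    and "x \<in> U \<Longrightarrow> g (r *\<^sub>R x) z = r * g x z"
    and "x \<in> U \<Longrightarrow> g (- x) z = - g x z"
    and "g 0 z = 0"
  using lin_on_add[OF lin[OF assms]] lin_on_diff[OF lin[OF assms] sub]
    lin_on_scale[OF lin[OF assms] sub] lin_on_minus[OF lin[OF assms] sub]
    lin_on_zero[OF lin[OF assms] sub] by auto

lemma right:
  assumes "z \<in> U"
  shows "x \<in> U \<Longrightarrow> y \<in> U \<Longrightarrow> g z (x + y) = g z x + g z y"
    and "x \<in> U \<Longrightarrow> y \<in> U \<Longrightarrow> g z (x - y) = g z x - g z y"
    and "x \<in> U \<Longrightarrow> g z (r *\<^sub>R x) = r * g z x"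
    and "x \<in> U \<Longrightarrow> g z (- x) = - g z x"
    and "g z 0 = 0"
  using left[OF assms] assms by (simp_all add: sym[of z])

lemma sum_left:
  "z \<in> U \<Longrightarrow> (\<And>i. i \<in> I \<Longrightarrow> h i \<in> U) \<Longrightarrow> g (\<Sum>i\<in>I. h i) z = (\<Sum>i\<in>I. g (h i) z)"
  using lin_on_sum[OF lin sub] by blast

lemma sum_right:
  "z \<in> U \<Longrightarrow> (\<And>i. i \<in> I \<Longrightarrow> h i \<in> U) \<Longrightarrow> g z (\<Sum>i\<in>I. h i) = (\<Sum>i\<in>I. g z (h i))"
  using sum_left[of z I h] by (simp add: sym[of z] sum_closed cong: sum.cong)

lemma eq_0_iff: "x \<in> U \<Longrightarrow> g x x = 0 \<longleftrightarrow> x = 0"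
  using pos[of x] left(5)[of 0] by (cases "x = 0") auto

lemma unit_multiple:
  assumes "x \<in> U" "x \<noteq> 0"
  obtains r where "g (r *\<^sub>R x) (r *\<^sub>R x) = 1"
proof
  show "g ((1 / sqrt (g x x)) *\<^sub>R x) ((1 / sqrt (g x x)) *\<^sub>R x) = 1"
    using assms pos[OF assms] by (simp add: left right)
qed

lemma finite_basis:
  obtains B where "finite B" "B \<subseteq> U" "independent B" "span B = U" "card B = dim U"
proof -
  obtain A where A: "finite A" "span A = U" using euclid by (auto simp: euclid_def)
  obtain B where B: "B \<subseteq> U" "independent B" "U \<subseteq> span B" "card B = dim U"
    using basis_exists[of U] by blast
  then have "finite B" using A independent_span_bound[of A B] by auto
  moreover have "span B = U" using B span_minimal[OF B(1) sub] by auto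
  ultimately show ?thesis using B that by blast
qed

lemma orthonormal_independent:
  assumes "B \<subseteq> U" "orthonormal g B"
  shows "independent B"
proof
  assume "dependent B"
  then obtain t u v where t: "finite t" "t \<subseteq> B" "(\<Sum>v\<in>t. u v *\<^sub>R v) = 0" "v \<in> t" "u v \<noteq> 0"
    unfolding dependent_explicit by blast
  have "0 = g (\<Sum>v\<in>t. u v *\<^sub>R v) v" using t assms by (auto simp: left)
  also have "\<dots> = (\<Sum>w\<in>t. u w * g w v)"
    using t assms by (subst sum_left) (auto intro!: sum.cong simp: left subset_iff)
  also have "\<dots> = (\<Sum>w\<in>t. if w = v then u v else 0)"
    using t assms by (intro sum.cong refl) (auto simp: orthonormal_def subset_iff)
  also have "\<dots> = u v" using t by simp
  finally show False using t by simp
qed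

lemma orthonormal_card:
  assumes "B \<subseteq> U" "orthonormal g B"
  shows "finite B" "card B \<le> dim U"
proof -
  obtain A where "finite A" "span A = U" "card A = dim U" by (rule finite_basis)
  then show "finite B" "card B \<le> dim U"
    using independent_span_bound[of A B] orthonormal_independent[OF assms] assms(1) by auto
qed

text \<open>One Gram-Schmidt step: take a vector outside the span, subtract its projection
  \<open>?p\<close> and normalise. The difference is nonzero because \<open>?p\<close> lies in the
  span.\<close>

lemma orthonormal_extend:
  assumes "B \<subseteq> U" "orthonormal g B" "\<not> U \<subseteq> span B"
  obtains t where "t \<in> U" "g t t = 1" "\<And>b. b \<in> B \<Longrightarrow> g t b = 0"
proof -
  have fin: "finite B" using orthonormal_card[OF assms(1,2)] by simp
  obtain u where u: "u \<in> U" "u \<notin> span B" using assms by auto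
  let ?p = "\<Sum>b\<in>B. g u b *\<^sub>R b"
  have p: "?p \<in> U" "?p \<in> span B"
    subgoal using assms(1) by (intro sum_closed) auto
    subgoal by (intro span_sum span_scale span_base)
    done
  have 0: "g (u - ?p) c = 0" if "c \<in> B" for c
  proof -
    have "g ?p c = (\<Sum>b\<in>B. g u b * g b c)"
      using assms that by (subst sum_left) (auto intro!: sum.cong simp: left subset_iff)
    also have "\<dots> = (\<Sum>b\<in>B. if b = c then g u c else 0)"
      using assms that by (intro sum.cong refl) (auto simp: orthonormal_def)
    also have "\<dots> = g u c" using that fin by simp
    finally show ?thesis using u p that assms(1) by (simp add: left subset_iff)
  qed
  have nz: "u - ?p \<noteq> 0" using u p by auto
  have mem: "u - ?p \<in> U" using u p by simp
  obtain r where "g (r *\<^sub>R (u - ?p)) (r *\<^sub>R (u - ?p)) = 1"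
    using unit_multiple[OF mem nz] by blast
  moreover have "g (r *\<^sub>R (u - ?p)) b = 0" if "b \<in> B" for b
    using 0[OF that] mem that assms(1) by (simp only: left subset_iff mult_zero_right)
  ultimately show ?thesis using that mem closed(3) by blast
qed

lemma orthonormal_extend_dim:
  assumes "B \<subseteq> U" "orthonormal g B" "card B < dim U"
  obtains t where "t \<in> U" "g t t = 1" "\<And>b. b \<in> B \<Longrightarrow> g t b = 0"
proof (rule orthonormal_extend[OF assms(1,2)])
  show "\<not> U \<subseteq> span B"
  proof
    assume "U \<subseteq> span B"
    obtain A where "independent A" "span A = U" "card A = dim U" by (rule finite_basis)
    then show False
      using independent_span_bound[of B A] orthonormal_card[OF assms(1,2)] assms(3)
        \<open>U \<subseteq> span B\<close> span_superset[of A] by auto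
  qed
qed (use that in blast)

lemma orthonormal_insert:
  assumes "B \<subseteq> U" "orthonormal g B" "t \<in> U" "g t t = 1" "\<And>b. b \<in> B \<Longrightarrow> g t b = 0"
  shows "orthonormal g (insert t B)" "t \<notin> B"
proof -
  have "g b t = 0" if "b \<in> B" for b using assms sym[of b t] that by auto
  then show "orthonormal g (insert t B)" "t \<notin> B" using assms by (auto simp: orthonormal_def)
qed

text \<open>Otherwise \<open>orthonormal_extend\<close> would produce more than \<open>dim U\<close>
  orthonormal vectors.\<close>

lemma orthonormal_spans:
  assumes "B \<subseteq> U" "orthonormal g B" "card B = dim U"
  shows "span B = U"
proof (rule ccontr)
  assume "span B \<noteq> U"
  then have "\<not> U \<subseteq> span B" using span_minimal[OF assms(1) sub] by auto
  then obtain t where t: "t \<in> U" "g t t = 1" "\<And>b. b \<in> B \<Longrightarrow> g t b = 0"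
    by (rule orthonormal_extend[OF assms(1,2)]) blast
  have "card (insert t B) \<le> dim U"
    using orthonormal_insert[OF assms(1,2) t] t assms by (intro orthonormal_card) auto
  then show False
    using orthonormal_insert[OF assms(1,2) t] orthonormal_card[OF assms(1,2)] assms(3) by simp
qed

end

section \<open>Isometries between carriers\<close>

lemma isometryD:
  assumes "isometry U g W h f"
  shows "bij_betw f U W" "inj_on f U" "f ` U = W" "lin_on U f"
    "\<And>x. x \<in> U \<Longrightarrow> f x \<in> W" "\<And>x y. x \<in> U \<Longrightarrow> y \<in> U \<Longrightarrow> h (f x) (f y) = g x y"
  using assms by (auto simp: isometry_def bij_betw_def)

text \<open>A form-preserving linear map is injective when the source form is definite. The
  hypotheses ask only for that definiteness, so the lemma applies to model spaces before they are
  known to satisfy \<open>euclid\<close>.\<close>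

lemma isometryI:
  assumes "subspace U" "h 0 0 = 0" "\<And>x. x \<in> U \<Longrightarrow> g x x = 0 \<Longrightarrow> x = 0" "lin_on U f" "f ` U = W"
    and "\<And>x y. x \<in> U \<Longrightarrow> y \<in> U \<Longrightarrow> h (f x) (f y) = g x y"
  shows "isometry U g W h f"
proof -
  have "inj_on f U"
  proof (rule inj_onI)
    fix x y assume xy: "x \<in> U" "y \<in> U" "f x = f y"
    have d: "x - y \<in> U" using xy assms(1) by (simp add: subspace_diff)
    have "f (x - y) = 0" using lin_on_diff[OF assms(4,1)] xy by simp
    then have "g (x - y) (x - y) = 0" using assms(2) assms(6)[OF d d] by simp
    then show "x = y" using assms(3)[OF d] by simp
  qed
  then show ?thesis using assms by (simp add: isometry_def bij_betw_def)
qed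

lemma isometry_inv:
  assumes "isometry U g W h f" "subspace U"
  shows "isometry W h U g (inv_into U f)"
proof -
  note D = isometryD[OF assms(1)]
  have b: "bij_betw (inv_into U f) W U" by (rule bij_betw_inv_into[OF D(1)])
  have "lin_on W (inv_into U f)"
    unfolding lin_on_def
  proof (intro ballI allI)
    fix x y r assume "x \<in> W" "y \<in> W"
    then obtain a c where a: "a \<in> U" "c \<in> U" "x = f a" "y = f c" using D(3) by auto
    have "f (r *\<^sub>R a + c) = r *\<^sub>R x + y" using a D(4) by (simp add: lin_on_def)
    then show "inv_into U f (r *\<^sub>R x + y) = r *\<^sub>R inv_into U f x + inv_into U f y"
      using a D(2) assms(2)
      by (metis inv_into_f_f subspace_add subspace_scale)
  qed
  moreover have "g (inv_into U f x) (inv_into U f y) = h x y" if "x \<in> W" "y \<in> W" for x y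
    using that D by (metis f_inv_into_f inv_into_into)
  ultimately show ?thesis using b by (simp add: isometry_def)
qed

lemma isometry_comp:
  assumes "isometry U g W h f" "isometry W h Z k f'"
  shows "isometry U g Z k (\<lambda>x. f' (f x))"
  using assms bij_betw_trans[of f U W f' Z]
  by (auto simp: isometry_def lin_on_def comp_def bij_betw_def)

lemma lin_on_image_subspace:
  assumes f: "lin_on U f" and U: "subspace U"
  shows "subspace (f ` U)"
  unfolding subspace_def
proof (intro conjI ballI allI)
  show "0 \<in> f ` U" using lin_on_zero[OF f U] subspace_0[OF U] by (metis imageI)
  fix x y c assume "x \<in> f ` U" "y \<in> f ` U"
  then obtain a b where a: "a \<in> U" "b \<in> U" "x = f a" "y = f b" by auto
  show "x + y \<in> f ` U"
    using a lin_on_add[OF f a(1,2)] subspace_add[OF U a(1,2)] by (metis imageI)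
  show "c *\<^sub>R x \<in> f ` U"
    using a lin_on_scale[OF f U a(1), of c] subspace_scale[OF U a(1), of c] by (metis imageI)
qed

lemma isometry_subspace: "isometry U g W h f \<Longrightarrow> subspace U \<Longrightarrow> subspace W"
  using isometryD(3,4) lin_on_image_subspace by metis

text \<open>The map is linear only on \<open>U\<close>, so a basis is carried over by explicit
  linear combinations: injectivity on \<open>U\<close> keeps it independent, surjectivity keeps it
  spanning.\<close>

lemma isometry_dim:
  assumes "isometry U g W h f" "euclid U g"
  shows "dim W = dim U"
proof -
  interpret U: euclid_sp U g by standard fact
  note D = isometryD[OF assms(1)]
  obtain B where B: "finite B" "B \<subseteq> U" "independent B" "span B = U" "card B = dim U"
    by (rule U.finite_basis)
  have inj: "inj_on f B" using D(2) B(2) by (rule inj_on_subset)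
  have ind: "independent (f ` B)"
  proof
    assume "dependent (f ` B)"
    then obtain u where u: "\<exists>v\<in>f ` B. u v \<noteq> 0" "(\<Sum>v\<in>f ` B. u v *\<^sub>R v) = 0"
      using B(1) by (auto simp: dependent_finite)
    have "(\<Sum>v\<in>f ` B. u v *\<^sub>R v) = (\<Sum>b\<in>B. f (u (f b) *\<^sub>R b))"
      using B by (subst sum.reindex[OF inj])
        (auto intro!: sum.cong simp: lin_on_scale[OF D(4) U.sub] subset_iff)
    also have "\<dots> = f (\<Sum>b\<in>B. u (f b) *\<^sub>R b)"
      using B(2) by (subst lin_on_sum[OF D(4) U.sub]) auto
    finally have "f (\<Sum>b\<in>B. u (f b) *\<^sub>R b) = f 0"
      using u lin_on_zero[OF D(4) U.sub] by simp
    moreover have "(\<Sum>b\<in>B. u (f b) *\<^sub>R b) \<in> U" using B(2) by (intro U.sum_closed) auto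
    ultimately have "(\<Sum>b\<in>B. u (f b) *\<^sub>R b) = 0"
      using D(2) U.closed(1) by (metis inj_onD)
    then show False using B u by (auto simp: dependent_finite)
  qed
  have "W \<subseteq> span (f ` B)"
  proof
    fix w assume "w \<in> W"
    then obtain x where x: "x \<in> span B" "w = f x" using D(3) B by auto
    then obtain c where c: "x = (\<Sum>b\<in>B. c b *\<^sub>R b)" using B(1) by (auto simp: span_finite)
    have "w = (\<Sum>b\<in>B. c b *\<^sub>R f b)"
      unfolding x c using B(2)
      by (subst lin_on_sum[OF D(4) U.sub])
        (auto intro!: sum.cong simp: lin_on_scale[OF D(4) U.sub] subset_iff)
    then show "w \<in> span (f ` B)" by (auto intro: span_sum span_scale span_base)
  qed
  then have "dim W = card (f ` B)"
    using ind D B(2) by (intro dim_unique[where B = "f ` B"]) auto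
  then show ?thesis using B(5) card_image[OF inj] by simp
qed

section \<open>Graded Clifford modules\<close>

locale cliff =
  fixes X :: "'x::real_vector set" and gX and Y :: "'y::real_vector set" and gY
    and Z :: "'z::real_vector set" and gZ and m m'
  assumes cl: "clmod X gX Y gY Z gZ m m'"
begin

sublocale X: euclid_sp X gX using cl by unfold_locales (simp add: clmod_def)
sublocale Y: euclid_sp Y gY using cl by unfold_locales (simp add: clmod_def)
sublocale Z: euclid_sp Z gZ using cl by unfold_locales (simp add: clmod_def)

lemma act [simp]:
  "x \<in> X \<Longrightarrow> y \<in> Y \<Longrightarrow> m x y \<in> Z" "x \<in> X \<Longrightarrow> z \<in> Z \<Longrightarrow> m' x z \<in> Y"
  using cl by (auto simp: clmod_def)

lemma lins:
  "y \<in> Y \<Longrightarrow> lin_on X (\<lambda>x. m x y)" "x \<in> X \<Longrightarrow> lin_on Y (m x)"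
  "z \<in> Z \<Longrightarrow> lin_on X (\<lambda>x. m' x z)" "x \<in> X \<Longrightarrow> lin_on Z (m' x)"
  using cl by (auto simp: clmod_def)

lemma lin1:
  assumes "y \<in> Y"
  shows "x \<in> X \<Longrightarrow> w \<in> X \<Longrightarrow> m (x + w) y = m x y + m w y"
    and "x \<in> X \<Longrightarrow> m (r *\<^sub>R x) y = r *\<^sub>R m x y" and "m 0 y = 0"
  using lin_on_add[OF lins(1)[OF assms]] lin_on_scale[OF lins(1)[OF assms] X.sub]
    lin_on_zero[OF lins(1)[OF assms] X.sub] by auto

lemma lin2:
  assumes "x \<in> X"
  shows "y \<in> Y \<Longrightarrow> w \<in> Y \<Longrightarrow> m x (y + w) = m x y + m x w"
    and "y \<in> Y \<Longrightarrow> m x (r *\<^sub>R y) = r *\<^sub>R m x y"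
    and "y \<in> Y \<Longrightarrow> m x (- y) = - m x y" and "m x 0 = 0"
  using lin_on_add[OF lins(2)[OF assms]] lin_on_scale[OF lins(2)[OF assms] Y.sub]
    lin_on_zero[OF lins(2)[OF assms] Y.sub] lin_on_minus[OF lins(2)[OF assms] Y.sub] by auto

lemma lin1':
  assumes "z \<in> Z"
  shows "x \<in> X \<Longrightarrow> w \<in> X \<Longrightarrow> m' (x + w) z = m' x z + m' w z"
    and "x \<in> X \<Longrightarrow> m' (r *\<^sub>R x) z = r *\<^sub>R m' x z" and "m' 0 z = 0"
  using lin_on_add[OF lins(3)[OF assms]] lin_on_scale[OF lins(3)[OF assms] X.sub]
    lin_on_zero[OF lins(3)[OF assms] X.sub] by auto

lemma lin2':
  assumes "x \<in> X"
  shows "z \<in> Z \<Longrightarrow> w \<in> Z \<Longrightarrow> m' x (z + w) = m' x z + m' x w"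
    and "z \<in> Z \<Longrightarrow> m' x (r *\<^sub>R z) = r *\<^sub>R m' x z"
    and "z \<in> Z \<Longrightarrow> m' x (- z) = - m' x z" and "m' x 0 = 0"
  using lin_on_add[OF lins(4)[OF assms]] lin_on_scale[OF lins(4)[OF assms] Z.sub]
    lin_on_zero[OF lins(4)[OF assms] Z.sub] lin_on_minus[OF lins(4)[OF assms] Z.sub] by auto

lemma square:
  "x \<in> X \<Longrightarrow> y \<in> Y \<Longrightarrow> m' x (m x y) = - (gX x x *\<^sub>R y)"
  "x \<in> X \<Longrightarrow> z \<in> Z \<Longrightarrow> m x (m' x z) = - (gX x x *\<^sub>R z)"
  using cl by (auto simp: clmod_def)

lemma skew:
  "x \<in> X \<Longrightarrow> y \<in> Y \<Longrightarrow> z \<in> Z \<Longrightarrow> gZ (m x y) z = - gY y (m' x z)"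
  using cl by (auto simp: clmod_def)

text \<open>Polarisation: expand the Clifford relation of \<open>x + w\<close> and subtract those of
  \<open>x\<close> and \<open>w\<close>.\<close>

lemma polar:
  assumes "x \<in> X" "w \<in> X" "y \<in> Y"
  shows "m' x (m w y) + m' w (m x y) = - ((2 * gX x w) *\<^sub>R y)"
proof -
  have "m' (x + w) (m (x + w) y) = - (gX (x + w) (x + w) *\<^sub>R y)"
    using assms by (simp add: square)
  then have *: "- (gX x x *\<^sub>R y) + m' w (m x y) + (m' x (m w y) + - (gX w w *\<^sub>R y)) =
      - ((gX x x + gX x w + (gX x w + gX w w)) *\<^sub>R y)"
    using assms by (simp add: lin1 lin1' lin2' X.left X.right X.sym[of w x] square)
  have "m' x (m w y) + m' w (m x y) =
      (- (gX x x *\<^sub>R y) + m' w (m x y) + (m' x (m w y) + - (gX w w *\<^sub>R y)))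
        + (gX x x *\<^sub>R y + gX w w *\<^sub>R y)"
    by simp
  also have "\<dots> = (- (gX x x + gX x w + (gX x w + gX w w)) + (gX x x + gX w w)) *\<^sub>R y"
    unfolding * by (simp only: scaleR_left_distrib scaleR_minus_left)
  also have "\<dots> = - ((2 * gX x w) *\<^sub>R y)"
    by (subst scaleR_minus_left[symmetric]) (rule arg_cong[where f = "\<lambda>r. r *\<^sub>R y"], simp)
  finally show ?thesis .
qed

lemma inner_polar:
  assumes "x \<in> X" "w \<in> X" "y \<in> Y" "u \<in> Y"
  shows "gZ (m x y) (m w u) + gZ (m w y) (m x u) = 2 * gX x w * gY y u"
proof -
  have "gZ (m x y) (m w u) + gZ (m w y) (m x u) = - gY y (m' x (m w u) + m' w (m x u))"
    using assms by (simp add: skew Y.right)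
  then show ?thesis using assms by (simp add: polar Y.right)
qed

lemma inner_act:
  assumes "x \<in> X" "y \<in> Y" "u \<in> Y"
  shows "gZ (m x y) (m x u) = gX x x * gY y u"
  using inner_polar[of x x y u] assms by simp

lemma inner_act_left:
  assumes "x \<in> X" "w \<in> X" "y \<in> Y"
  shows "gZ (m x y) (m w y) = gX x w * gY y y"
  using inner_polar[of x w y y] Z.sym[of "m x y" "m w y"] assms by simp

lemma act_eq_0:
  assumes "x \<in> X" "y \<in> Y" "m x y = 0" shows "x = 0 \<or> y = 0"
  using inner_act[of x y y] assms Z.left(5)[of 0] X.eq_0_iff[of x] Y.eq_0_iff[of y] by simp

text \<open>This is what lets a unit vector identify the even with the odd part. Since u^{-1} = -u,
  a preimage of \<open>z\<close> is \<open>- m' u z\<close>.\<close>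

lemma isometry_unit:
  assumes "u \<in> X" "gX u u = 1"
  shows "isometry Y gY Z gZ (m u)"
proof (rule isometryI)
  show "m u ` Y = Z"
  proof
    show "Z \<subseteq> m u ` Y"
    proof
      fix z assume "z \<in> Z"
      then have "m u (- m' u z) = z" "- m' u z \<in> Y" using assms by (auto simp: lin2 square)
      then show "z \<in> m u ` Y" by (metis imageI)
    qed
  qed (use assms in auto)
qed (use assms in \<open>auto simp: Y.sub Z.left Y.eq_0_iff lins inner_act\<close>)

text \<open>With respect to a unit vector \<open>u\<close>, which identifies \<open>Z\<close> with \<open>Y\<close>, every \<open>x\<close> becomes an
  endomorphism of \<open>Y\<close>.\<close>
definition rot :: "'x \<Rightarrow> 'x \<Rightarrow> 'y \<Rightarrow> 'y" where
  "rot u x y = - m' u (m x y)"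

context
  fixes u assumes u: "u \<in> X" "gX u u = 1"
begin

lemma rot_mem [simp]: "x \<in> X \<Longrightarrow> y \<in> Y \<Longrightarrow> rot u x y \<in> Y"
  using u by (simp add: rot_def)

lemma act_rot: "x \<in> X \<Longrightarrow> y \<in> Y \<Longrightarrow> m u (rot u x y) = m x y"
  using u by (simp add: rot_def lin2 square)

lemma rot_self: "y \<in> Y \<Longrightarrow> rot u u y = y"
  using u by (simp add: rot_def square)

lemma rot_lin1: "y \<in> Y \<Longrightarrow> lin_on X (\<lambda>x. rot u x y)"
  using u by (intro lin_onI X.sub) (auto simp: rot_def lin1 lin2')

lemma rot_lin2: "x \<in> X \<Longrightarrow> lin_on Y (rot u x)"
  using u by (intro lin_onI Y.sub) (auto simp: rot_def lin2 lin2')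

text \<open>Since \<open>rot u u\<close> is the identity, this says that the adjoint of
  \<open>rot u x\<close> belongs to 2<u,x>u - x. Reflection fixing the line of \<open>u\<close> thus
  plays the part of conjugation, with \<open>u\<close> as the unit element.\<close>

lemma rot_adjoint:
  assumes "x \<in> X" "y \<in> Y" "w \<in> Y"
  shows "gY (rot u x y) w + gY y (rot u x w) = 2 * gX u x * gY y w"
proof -
  have 1: "gY (rot u x y) w = gZ (m x y) (m u w)" if "y \<in> Y" "w \<in> Y" for y w
    using that assms(1) u skew[OF u(1) that(2), of "m x y"]
    by (simp add: rot_def Y.left Z.sym[of "m x y" "m u w"] Y.sym[of "m' u (m x y)" w])
  show ?thesis
    using 1[of y w] 1[of w y] inner_polar[OF assms(1) u(1) assms(2,3)] assms u
    by (simp add: Y.sym[of y "rot u x w"] Z.sym[of "m x w" "m u y"] X.sym[of u x])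
qed

lemma rot_inner:
  assumes "x \<in> X" "y \<in> Y" "w \<in> Y"
  shows "gY (rot u x y) (rot u x w) = gX x x * gY y w"
  using inner_act[OF u(1), of "rot u x y" "rot u x w"] inner_act[OF assms] assms u
  by (simp add: act_rot)

lemma rot_anticommute:
  assumes "x \<in> X" "w \<in> X" "gX u x = 0" "gX u w = 0" "y \<in> Y"
  shows "rot u x (rot u w y) + rot u w (rot u x y) = - ((2 * gX x w) *\<^sub>R y)"
proof -
  \<comment> \<open>For \<open>a\<close> orthogonal to \<open>u\<close> the two factors may be
    exchanged at the cost of a sign. The outer rotation then ends in \<open>m u\<close>, which
    cancels the inner one by \<open>act_rot\<close>, and \<open>polar\<close> finishes.\<close>
  have *: "rot u a b = m' a (m u b)" if "a \<in> X" "gX u a = 0" "b \<in> Y" for a b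
    using polar[OF u(1), of a b] that by (simp add: rot_def neg_eq_iff_add_eq_0)
  show ?thesis using assms polar[of x w y] by (simp add: * [of _ "rot u _ _"] act_rot)
qed

end

end

text \<open>The facts about the source of an isomorphism that \<open>intertwine_inv\<close> uses, in
  place of a full module structure. The clause on \<open>m' 0 z\<close> handles x = 0, where the
  Clifford relation cannot be divided by the norm.\<close>

definition pre_cliff :: "'x::real_vector set \<Rightarrow> ('x \<Rightarrow> 'x \<Rightarrow> real) \<Rightarrow> 'y::real_vector set \<Rightarrow>
    'z::real_vector set \<Rightarrow> ('x \<Rightarrow> 'y \<Rightarrow> 'z) \<Rightarrow> ('x \<Rightarrow> 'z \<Rightarrow> 'y) \<Rightarrow> bool" where
  "pre_cliff X h Y Z m m' \<longleftrightarrow> (\<forall>x\<in>X. \<forall>y\<in>Y. m x y \<in> Z) \<and> (\<forall>x\<in>X. \<forall>z\<in>Z. m' x z \<in> Y)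
     \<and> (\<forall>x\<in>X. \<forall>z\<in>Z. m x (m' x z) = - (h x x *\<^sub>R z)) \<and> (\<forall>z\<in>Z. m' 0 z = 0)"

lemma clmod_pre_cliff:
  assumes "clmod X gX Y gY Z gZ m m'" shows "pre_cliff X gX Y Z m m'"
proof -
  interpret cliff X gX Y gY Z gZ m m' by standard fact
  show ?thesis by (simp add: pre_cliff_def square lin1')
qed

text \<open>The action on the odd part need not be intertwined by assumption: the Clifford relation
  determines it from the action on the even part.\<close>
lemma intertwine_inv:
  fixes fX :: "'x2::real_vector \<Rightarrow> 'x::real_vector" and fY :: "'y2::real_vector \<Rightarrow> 'y::real_vector"
    and fZ :: "'z2::real_vector \<Rightarrow> 'z::real_vector"
  assumes cl: "clmod X gX Y gY Z gZ m m'"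
    and X: "isometry X0 hX X gX fX" "subspace X0"
    and Y: "isometry Y0 hY Y gY fY" "subspace Y0"
    and Z: "isometry Z0 hZ Z gZ fZ" "subspace Z0"
    and pre: "pre_cliff X0 hX Y0 Z0 m0 m0'"
    and int: "\<And>x y. x \<in> X0 \<Longrightarrow> y \<in> Y0 \<Longrightarrow> fZ (m0 x y) = m (fX x) (fY y)"
  shows "\<forall>x\<in>X. \<forall>y\<in>Y. inv_into Z0 fZ (m x y) = m0 (inv_into X0 fX x) (inv_into Y0 fY y)"
    and "\<forall>x\<in>X. \<forall>z\<in>Z. inv_into Y0 fY (m' x z) = m0' (inv_into X0 fX x) (inv_into Z0 fZ z)"
proof -
  interpret cliff X gX Y gY Z gZ m m' by standard fact
  have closed: "\<And>x y. x \<in> X0 \<Longrightarrow> y \<in> Y0 \<Longrightarrow> m0 x y \<in> Z0"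
    and closed': "\<And>x z. x \<in> X0 \<Longrightarrow> z \<in> Z0 \<Longrightarrow> m0' x z \<in> Y0"
    and sq: "\<And>x z. x \<in> X0 \<Longrightarrow> z \<in> Z0 \<Longrightarrow> m0 x (m0' x z) = - (hX x x *\<^sub>R z)"
    and zero: "\<And>z. z \<in> Z0 \<Longrightarrow> m0' 0 z = 0"
    using pre by (auto simp: pre_cliff_def)
  note DX = isometryD[OF X(1)] and DY = isometryD[OF Y(1)] and DZ = isometryD[OF Z(1)]
  show "\<forall>x\<in>X. \<forall>y\<in>Y. inv_into Z0 fZ (m x y) = m0 (inv_into X0 fX x) (inv_into Y0 fY y)"
  proof (intro ballI)
    fix x y assume "x \<in> X" "y \<in> Y"
    then obtain a b where "a \<in> X0" "x = fX a" "b \<in> Y0" "y = fY b" using DX(3) DY(3) by auto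
    then show "inv_into Z0 fZ (m x y) = m0 (inv_into X0 fX x) (inv_into Y0 fY y)"
      using DX(2) DY(2) DZ(2) closed[of a b] by (simp flip: int)
  qed
  show "\<forall>x\<in>X. \<forall>z\<in>Z. inv_into Y0 fY (m' x z) = m0' (inv_into X0 fX x) (inv_into Z0 fZ z)"
  proof (intro ballI)
    fix x z assume "x \<in> X" "z \<in> Z"
    then obtain a c where a: "a \<in> X0" "x = fX a" and c: "c \<in> Z0" "z = fZ c"
      using DX(3) DZ(3) by auto
    have eq: "fY (m0' a c) = m' x z"
    proof (cases "x = 0")
      case True
      then have "a = 0"
        using a DX(2) lin_on_zero[OF DX(4) X(2)] subspace_0[OF X(2)] by (metis inj_onD)
      then show ?thesis
        using True c DZ(5) zero lin_on_zero[OF DY(4) Y(2)] by (simp add: lin1')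
    next
      case False
      have p: "gX x x \<noteq> 0" using False \<open>x \<in> X\<close> X.pos by force
      \<comment> \<open>Both candidates for the odd action become -|x|^2 z under \<open>m x\<close>;
        applying \<open>m' x\<close> and dividing by |x|^2 makes them equal.\<close>
      have "m x (fY (m0' a c)) = fZ (m0 a (m0' a c))" using a c closed' int by simp
      also have "\<dots> = - (gX x x *\<^sub>R z)"
        using a c DX(6)[OF a(1) a(1)] Z(2)
        by (simp add: sq lin_on_minus[OF DZ(4) Z(2)] lin_on_scale[OF DZ(4) Z(2)] subspace_scale)
      finally have "m' x (m x (fY (m0' a c))) = m' x (- (gX x x *\<^sub>R z))" by simp
      then have "gX x x *\<^sub>R fY (m0' a c) = gX x x *\<^sub>R m' x z"
        using \<open>x \<in> X\<close> \<open>z \<in> Z\<close> DY(5) closed' a c by (simp add: square lin2')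
      then show ?thesis using p by simp
    qed
    then show "inv_into Y0 fY (m' x z) = m0' (inv_into X0 fX x) (inv_into Z0 fZ z)"
      using a c DX(2) DZ(2) inv_into_f_f[OF DY(2) closed'[OF a(1) c(1)]] by simp
  qed
qed

section \<open>Isomorphisms of Clifford extensions\<close>

text \<open>The maps run from \<open>F\<close> to \<open>E\<close>, and their inverses form the
  isomorphism. The four odd actions are obtained from \<open>intertwine_inv\<close>.\<close>

lemma cdata_isoI:
  fixes E :: "('v::real_vector,'s::real_vector,'r::real_vector,'t::real_vector,'u::real_vector,'w::real_vector) cdata"
    and F :: "('v2::real_vector,'s2::real_vector,'r2::real_vector,'t2::real_vector,'u2::real_vector,'w2::real_vector) cdata"
  assumes E: "clifford_extension E"
    and V: "isometry (cV F) (gV F) (cV E) (gV E) fV" "subspace (cV F)"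
    and S0: "isometry (cS0 F) (gS0 F) (cS0 E) (gS0 E) fS0" "subspace (cS0 F)"
    and S1: "isometry (cS1 F) (gS1 F) (cS1 E) (gS1 E) fS1" "subspace (cS1 F)"
    and T1: "isometry (cT1 F) (gT1 F) (cT1 E) (gT1 E) fT1" "subspace (cT1 F)"
    and T2: "isometry (cT2 F) (gT2 F) (cT2 E) (gT2 E) fT2" "subspace (cT2 F)"
    and T3: "isometry (cT3 F) (gT3 F) (cT3 E) (gT3 E) fT3" "subspace (cT3 F)"
    and VS: "pre_cliff (cV F) (gV F) (cS0 F) (cS1 F) (actVS0 F) (actVS1 F)"
      "\<And>v s. v \<in> cV F \<Longrightarrow> s \<in> cS0 F \<Longrightarrow> fS1 (actVS0 F v s) = actVS0 E (fV v) (fS0 s)"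
    and ST: "pre_cliff (cS0 F) (gS0 F) (cT1 F) (cT2 F) (actS0T1 F) (actS0T2 F)"
      "\<And>s t. s \<in> cS0 F \<Longrightarrow> t \<in> cT1 F \<Longrightarrow> fT2 (actS0T1 F s t) = actS0T1 E (fS0 s) (fT1 t)"
    and RT: "pre_cliff (cS1 F) (gS1 F) (cT1 F) (cT3 F) (actS1T1 F) (actS1T3 F)"
      "\<And>s t. s \<in> cS1 F \<Longrightarrow> t \<in> cT1 F \<Longrightarrow> fT3 (actS1T1 F s t) = actS1T1 E (fS1 s) (fT1 t)"
    and VT: "pre_cliff (cV F) (gV F) (cT2 F) (cT3 F) (actVT2 F) (actVT3 F)"
      "\<And>v t. v \<in> cV F \<Longrightarrow> t \<in> cT2 F \<Longrightarrow> fT3 (actVT2 F v t) = actVT2 E (fV v) (fT2 t)"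
  shows "cdata_iso E F"
proof -
  note cl = E[unfolded clifford_extension_def]
  have VScl: "clmod (cV E) (gV E) (cS0 E) (gS0 E) (cS1 E) (gS1 E) (actVS0 E) (actVS1 E)"
    and VTcl: "clmod (cV E) (gV E) (cT2 E) (gT2 E) (cT3 E) (gT3 E) (actVT2 E) (actVT3 E)"
    and STcl: "clmod (cS0 E) (gS0 E) (cT1 E) (gT1 E) (cT2 E) (gT2 E) (actS0T1 E) (actS0T2 E)"
    and RTcl: "clmod (cS1 E) (gS1 E) (cT1 E) (gT1 E) (cT3 E) (gT3 E) (actS1T1 E) (actS1T3 E)"
    using cl by auto
  show ?thesis
    unfolding cdata_iso_def
    by (intro exI[of _ "inv_into (cV F) fV"] exI[of _ "inv_into (cS0 F) fS0"]
      exI[of _ "inv_into (cS1 F) fS1"] exI[of _ "inv_into (cT1 F) fT1"]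
      exI[of _ "inv_into (cT2 F) fT2"] exI[of _ "inv_into (cT3 F) fT3"] conjI
      isometry_inv[OF V] isometry_inv[OF S0] isometry_inv[OF S1]
      isometry_inv[OF T1] isometry_inv[OF T2] isometry_inv[OF T3]
      intertwine_inv[OF VScl V S0 S1 VS] intertwine_inv[OF STcl S0 T1 T2 ST]
      intertwine_inv[OF RTcl S1 T1 T3 RT] intertwine_inv[OF VTcl V T2 T3 VT])
qed

lemma lin_on_comp:
  "lin_on U f \<Longrightarrow> (\<And>x. x \<in> U \<Longrightarrow> f x \<in> W) \<Longrightarrow> lin_on W h \<Longrightarrow> lin_on U (\<lambda>x. h (f x))"
  by (simp add: lin_on_def)

text \<open>Moves the action of S^0 on T_1 and T_2 to carriers in the type that the theorem
  prescribes for the witnesses of case (a).\<close>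

lemma clmod_pullback:
  fixes fX :: "'x2::real_vector \<Rightarrow> 'x::real_vector" and fY :: "'y2::real_vector \<Rightarrow> 'y::real_vector"
    and fZ :: "'z2::real_vector \<Rightarrow> 'z::real_vector"
  assumes cl: "clmod X gX Y gY Z gZ m m'"
    and X: "isometry X0 hX X gX fX" "euclid X0 hX"
    and Y: "isometry Y0 hY Y gY fY" "euclid Y0 hY"
    and Z: "isometry Z0 hZ Z gZ fZ" "euclid Z0 hZ"
  shows "clmod X0 hX Y0 hY Z0 hZ (\<lambda>x y. inv_into Z0 fZ (m (fX x) (fY y)))
    (\<lambda>x z. inv_into Y0 fY (m' (fX x) (fZ z)))"
proof -
  interpret cliff X gX Y gY Z gZ m m' by standard fact
  interpret Y0: euclid_sp Y0 hY by standard fact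
  interpret Z0: euclid_sp Z0 hZ by standard fact
  note DX = isometryD[OF X(1)] and DY = isometryD[OF Y(1)] and DZ = isometryD[OF Z(1)]
  note IY = isometryD[OF isometry_inv[OF Y(1) Y0.sub]]
  note IZ = isometryD[OF isometry_inv[OF Z(1) Z0.sub]]
  have fi: "\<And>y. y \<in> Y \<Longrightarrow> fY (inv_into Y0 fY y) = y" "\<And>z. z \<in> Z \<Longrightarrow> fZ (inv_into Z0 fZ z) = z"
    using DY(3) DZ(3) by (auto intro: f_inv_into_f)
  have skew0: "hZ (inv_into Z0 fZ w) z = gZ w (fZ z)" if "w \<in> Z" "z \<in> Z0" for w z
    using DZ(6)[OF IZ(5)[OF that(1)] that(2)] fi that by simp
  have skew1: "hY y (inv_into Y0 fY w) = gY (fY y) w" if "w \<in> Y" "y \<in> Y0" for w y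
    using DY(6)[OF that(2) IY(5)[OF that(1)]] fi that by simp
  show ?thesis
    unfolding clmod_def
  proof (intro conjI ballI)
    fix x assume x: "x \<in> X0"
    then have fx: "fX x \<in> X" by (rule DX(5))
    show "lin_on Y0 (\<lambda>y. inv_into Z0 fZ (m (fX x) (fY y)))"
      using fx by (intro lin_on_comp[OF _ _ IZ(4)] lin_on_comp[OF DY(4) _ lins(2)]) (simp_all add: DY(5))
    show "lin_on Z0 (\<lambda>z. inv_into Y0 fY (m' (fX x) (fZ z)))"
      using fx by (intro lin_on_comp[OF _ _ IY(4)] lin_on_comp[OF DZ(4) _ lins(4)]) (simp_all add: DZ(5))
  next
    fix y assume "y \<in> Y0"
    then show "lin_on X0 (\<lambda>x. inv_into Z0 fZ (m (fX x) (fY y)))"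
      by (intro lin_on_comp[OF _ _ IZ(4)] lin_on_comp[OF DX(4) _ lins(1)]) (simp_all add: DX(5) DY(5))
  next
    fix z assume "z \<in> Z0"
    then show "lin_on X0 (\<lambda>x. inv_into Y0 fY (m' (fX x) (fZ z)))"
      by (intro lin_on_comp[OF _ _ IY(4)] lin_on_comp[OF DX(4) _ lins(3)]) (simp_all add: DX(5) DZ(5))
  next
    fix x y assume "x \<in> X0" "y \<in> Y0"
    then show "inv_into Y0 fY (m' (fX x) (fZ (inv_into Z0 fZ (m (fX x) (fY y))))) = - (hX x x *\<^sub>R y)"
      using DX(5,6) DY(2,5)
      by (simp add: fi square lin_on_minus[OF IY(4) Y.sub] lin_on_scale[OF IY(4) Y.sub])
  next
    fix x z assume "x \<in> X0" "z \<in> Z0"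
    then show "inv_into Z0 fZ (m (fX x) (fY (inv_into Y0 fY (m' (fX x) (fZ z))))) = - (hX x x *\<^sub>R z)"
      using DX(5,6) DZ(2,5)
      by (simp add: fi square lin_on_minus[OF IZ(4) Z.sub] lin_on_scale[OF IZ(4) Z.sub])
  qed (use X(2) Y(2) Z(2) DX(5) DY(5) DZ(5) IY(5) IZ(5) in \<open>simp_all add: skew0 skew1 skew\<close>)
qed

section \<open>Coordinates for abstract Euclidean spaces\<close>

lemma subspace_An: "subspace (An n :: (nat \<Rightarrow> 'a::real_vector) set)"
  by (auto simp: subspace_def An_def scaleR_fun_def)

lemma sum_fun_apply: "(\<Sum>i\<in>I. h i) x = (\<Sum>i\<in>I. h i x)"
  for h :: "'i \<Rightarrow> 'a \<Rightarrow> 'b::comm_monoid_add"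
  by (induction I rule: infinite_finite_induct) auto

text \<open>Any basis will do, orthonormal or not, because the metric on the coordinate space is
  pulled back along \<open>f\<close>.\<close>

lemma euclid_coordinates:
  fixes U :: "'a::real_vector set"
  assumes "euclid U g"
  obtains U' :: "(nat \<Rightarrow> real) set" and g' f where "euclid U' g'" "isometry U' g' U g f"
proof -
  interpret euclid_sp U g by standard fact
  obtain B where B: "finite B" "B \<subseteq> U" "independent B" "span B = U" by (rule finite_basis)
  obtain e where e: "bij_betw e {..<card B} B"
    using ex_bij_betw_nat_finite[OF B(1)] by (auto simp: atLeast0LessThan)
  define n where "n = card B"
  define f where "f c = (\<Sum>i<n. c i *\<^sub>R e i)" for c :: "nat \<Rightarrow> real"
  define U' :: "(nat \<Rightarrow> real) set" where "U' = An n"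
  define g' where "g' c d = g (f c) (f d)" for c d
  have eU: "e i \<in> U" if "i < n" for i using e that B(2) by (auto simp: n_def bij_betw_def)
  have fU [simp]: "f c \<in> U" for c unfolding f_def by (intro sum_closed closed eU) simp
  have fadd: "f (c + d) = f c + f d" and fscale: "f (r *\<^sub>R c) = r *\<^sub>R f c" for c d r
    by (simp_all add: f_def sum.distrib scaleR_left_distrib scaleR_fun_def scaleR_right.sum)
  have sub': "subspace U'" unfolding U'_def by (rule subspace_An)
  \<comment> \<open>The same sum indexed by basis vectors, the form to which independence of
    \<open>B\<close> applies.\<close>
  have reindex: "f c = (\<Sum>b\<in>B. c (inv_into {..<n} e b) *\<^sub>R b)" for c
    unfolding f_def n_def using e sum.reindex_bij_betw[OF e, of "\<lambda>b. c (inv_into {..<n} e b) *\<^sub>R b"]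
    by (simp add: n_def bij_betw_def)
  have zero: "c = 0" if "c \<in> U'" "f c = 0" for c
  proof
    fix i
    show "c i = 0 i"
    proof (cases "i < n")
      case True
      have "c (inv_into {..<n} e b) = 0" if "b \<in> B" for b
        using \<open>f c = 0\<close> unfolding reindex
        by (rule real_vector.independentD[OF B(3,1) order_refl _ that])
      moreover have "e i \<in> B" "inv_into {..<n} e (e i) = i"
        using True e by (auto simp: n_def bij_betw_def)
      ultimately show ?thesis by (metis zero_fun_apply)
    qed (use that in \<open>simp add: U'_def An_def\<close>)
  qed
  have img: "f ` U' = U"
  proof
    show "U \<subseteq> f ` U'"
    proof
      fix x assume "x \<in> U"
      then obtain u where u: "x = (\<Sum>b\<in>B. u b *\<^sub>R b)" using B by (auto simp: span_finite)
      have "x = f (\<lambda>i. if i < n then u (e i) else 0)"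
        unfolding u f_def using sum.reindex_bij_betw[OF e, of "\<lambda>b. u b *\<^sub>R b"]
        by (simp add: n_def)
      then show "x \<in> f ` U'" by (auto simp: U'_def An_def)
    qed
  qed auto
  have "euclid U' g'"
    unfolding euclid_def
  proof (intro conjI ballI impI)
    let ?D = "(\<lambda>i j. if j = i then 1 else 0 :: real) ` {..<n}"
    have "c \<in> span ?D" if "c \<in> U'" for c
    proof -
      have "c = (\<Sum>i<n. c i *\<^sub>R (\<lambda>j. if j = i then 1 else 0))"
      proof
        fix j show "c j = (\<Sum>i<n. c i *\<^sub>R (\<lambda>j. if j = i then 1 else 0)) j"
          using that by (cases "j < n") (auto simp: sum_fun_apply scaleR_fun_def U'_def An_def if_distrib cong: if_cong)
      qed
      also have "\<dots> \<in> span ?D" by (intro span_sum span_scale span_base) auto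
      finally show ?thesis .
    qed
    moreover have D: "?D \<subseteq> U'" by (auto simp: U'_def An_def)
    ultimately have "span ?D = U'" using span_minimal[OF D sub'] by auto
    then show "\<exists>B. finite B \<and> B \<subseteq> U' \<and> span B = U'" using D by blast
  qed (use sub' zero in \<open>auto simp: g'_def sym[of "f _" "f _"] fadd fscale left right intro!: lin_onI pos\<close>)
  moreover have "isometry U' g' U g f"
  proof (rule isometryI)
    show "x = 0" if "x \<in> U'" "g' x x = 0" for x
      using zero[OF that(1)] that(2) eq_0_iff[of "f x"] by (simp add: g'_def)
  qed (use sub' img left(5)[of 0] in \<open>auto simp: g'_def fadd fscale intro!: lin_onI\<close>)
  ultimately show ?thesis by (rule that)
qed

section \<open>Associative extensions, and the case dim V = 1\<close>

locale assoc_clifford =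
  fixes E :: "('v::real_vector,'s::real_vector,'r::real_vector,'t::real_vector,'u::real_vector,'w::real_vector) cdata"
  assumes ext: "clifford_extension E"
    and assoc: "associative_ext E"
    and T1_nz: "cT1 E \<noteq> {0}"
begin

sublocale V: euclid_sp "cV E" "gV E"
  using ext by unfold_locales (simp add: clifford_extension_def clmod_def)
sublocale S0: euclid_sp "cS0 E" "gS0 E"
  using ext by unfold_locales (simp add: clifford_extension_def clmod_def)
sublocale S1: euclid_sp "cS1 E" "gS1 E"
  using ext by unfold_locales (simp add: clifford_extension_def clmod_def)
sublocale T1: euclid_sp "cT1 E" "gT1 E"
  using ext by unfold_locales (simp add: clifford_extension_def clmod_def)
sublocale T2: euclid_sp "cT2 E" "gT2 E"
  using ext by unfold_locales (simp add: clifford_extension_def clmod_def)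
sublocale T3: euclid_sp "cT3 E" "gT3 E"
  using ext by unfold_locales (simp add: clifford_extension_def clmod_def)
sublocale VS: cliff "cV E" "gV E" "cS0 E" "gS0 E" "cS1 E" "gS1 E" "actVS0 E" "actVS1 E"
  using ext by unfold_locales (simp add: clifford_extension_def)
sublocale ST: cliff "cS0 E" "gS0 E" "cT1 E" "gT1 E" "cT2 E" "gT2 E" "actS0T1 E" "actS0T2 E"
  using ext by unfold_locales (simp add: clifford_extension_def)
sublocale RT: cliff "cS1 E" "gS1 E" "cT1 E" "gT1 E" "cT3 E" "gT3 E" "actS1T1 E" "actS1T3 E"
  using ext by unfold_locales (simp add: clifford_extension_def)
sublocale VT: cliff "cV E" "gV E" "cT2 E" "gT2 E" "cT3 E" "gT3 E" "actVT2 E" "actVT3 E"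
  using ext by unfold_locales (simp add: clifford_extension_def)

lemma associative:
  "v \<in> cV E \<Longrightarrow> s \<in> cS0 E \<Longrightarrow> t \<in> cT1 E \<Longrightarrow>
    actS1T1 E (actVS0 E v s) t = actVT2 E v (actS0T1 E s t)"
  using assoc by (simp add: associative_ext_def)

lemma unit_V:
  obtains v where "v \<in> cV E" "gV E v v = 1"
proof -
  obtain v where "v \<in> cV E" "v \<noteq> 0"
    using ext V.closed(1) unfolding clifford_extension_def by blast
  then show ?thesis using V.unit_multiple that V.closed(3) by metis
qed

text \<open>The nonzero vector granted by the hypotheses may lie in S^1; a unit vector of V then
  carries it into S^0 without killing it.\<close>

lemma S0_nz:
  obtains s where "s \<in> cS0 E" "s \<noteq> 0"
proof -
  obtain v where v: "v \<in> cV E" "gV E v v = 1" by (rule unit_V)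
  have "actVS1 E v s \<noteq> 0" if "s \<in> cS1 E" "s \<noteq> 0" for s
    using VS.square(2)[OF v(1) that(1)] VS.lin2(4)[OF v(1)] v that by auto
  then show ?thesis
    using ext that v unfolding clifford_extension_def by (metis VS.act(2))
qed

text \<open>When V is the line of \<open>v\<close>, its action is scalar multiplication once S^1 and
  T_3 are replaced by S^0 and T_2 through \<open>v\<close>. Only one genuine Clifford action
  remains, that of S^0, and its coordinate version gives the witnesses.\<close>

lemma dim_V_1:
  assumes "dim (cV E) = 1"
  shows "\<exists>(Vt :: (nat \<Rightarrow> real) set) gVt (St0 :: (nat \<Rightarrow> real) set) g0
               (St1 :: (nat \<Rightarrow> real) set) g1 m m'.
               Vt \<noteq> {0} \<and> clmod Vt gVt St0 g0 St1 g1 m m' \<and>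
               cdata_iso E (real_line_data Vt gVt St0 g0 St1 g1 m m')"
proof -
  obtain v where v: "v \<in> cV E" "gV E v v = 1" by (rule unit_V)
  obtain A :: "(nat \<Rightarrow> real) set" and gA fA where A: "euclid A gA" "isometry A gA (cS0 E) (gS0 E) fA"
    by (rule euclid_coordinates[OF S0.euclid])
  obtain B :: "(nat \<Rightarrow> real) set" and gB fB where B: "euclid B gB" "isometry B gB (cT1 E) (gT1 E) fB"
    by (rule euclid_coordinates[OF T1.euclid])
  obtain C :: "(nat \<Rightarrow> real) set" and gC fC where C: "euclid C gC" "isometry C gC (cT2 E) (gT2 E) fC"
    by (rule euclid_coordinates[OF T2.euclid])
  interpret A: euclid_sp A gA by standard fact
  interpret B: euclid_sp B gB by standard fact
  interpret C: euclid_sp C gC by standard fact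
  note DA = isometryD[OF A(2)] and DB = isometryD[OF B(2)] and DC = isometryD[OF C(2)]
  define m where "m x y = inv_into C fC (actS0T1 E (fA x) (fB y))" for x y
  define m' where "m' x z = inv_into B fB (actS0T2 E (fA x) (fC z))" for x z
  have cl: "clmod A gA B gB C gC m m'"
    using clmod_pullback[OF ST.cl A(2,1) B(2,1) C(2,1)] by (simp add: m_def[abs_def] m'_def[abs_def])
  let ?F = "real_line_data A gA B gB C gC m m'"
  have "A \<noteq> {0}"
  proof
    assume *: "A = {0}"
    have "cS0 E = {fA 0}" using DA(3) unfolding * by simp
    then show False using S0_nz S0.closed(1) by (metis singletonD)
  qed
  moreover have "cdata_iso E ?F"
  proof (rule cdata_isoI[OF ext])
    have "span {v} = cV E"
      using v assms by (intro V.orthonormal_spans) (auto simp: orthonormal_def)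
    then have range: "range (\<lambda>a. a *\<^sub>R v) = cV E" by (simp add: span_singleton)
    have "isometry UNIV (*) (cV E) (gV E) (\<lambda>a. a *\<^sub>R v)"
    proof (rule isometryI)
      show "lin_on UNIV (\<lambda>a. a *\<^sub>R v)" by (simp add: lin_on_def scaleR_left_distrib)
    qed (use v range in \<open>simp_all add: V.left V.right\<close>)
    then show "isometry (cV ?F) (gV ?F) (cV E) (gV E) (\<lambda>a. a *\<^sub>R v)"
      by (simp add: real_line_data_def)
    show "isometry (cS0 ?F) (gS0 ?F) (cS0 E) (gS0 E) fA"
      using A by (simp add: real_line_data_def)
    show "isometry (cS1 ?F) (gS1 ?F) (cS1 E) (gS1 E) (\<lambda>x. actVS0 E v (fA x))"
      using isometry_comp[OF A(2) VS.isometry_unit[OF v]] by (simp add: real_line_data_def)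
    show "isometry (cT1 ?F) (gT1 ?F) (cT1 E) (gT1 E) fB"
      using B by (simp add: real_line_data_def)
    show "isometry (cT2 ?F) (gT2 ?F) (cT2 E) (gT2 E) fC"
      using C by (simp add: real_line_data_def)
    show "isometry (cT3 ?F) (gT3 ?F) (cT3 E) (gT3 E) (\<lambda>x. actVT2 E v (fC x))"
      using isometry_comp[OF C(2) VT.isometry_unit[OF v]] by (simp add: real_line_data_def)
    have fm: "fC (m x y) = actS0T1 E (fA x) (fB y)" if "x \<in> A" "y \<in> B" for x y
      unfolding m_def using that DA(5) DB(5) DC(3) f_inv_into_f[of "actS0T1 E (fA x) (fB y)" fC C] by simp
    note [simp] = real_line_data_def and [simp] = clmod_pre_cliff[OF cl]
    show "fC (actS0T1 ?F s t) = actS0T1 E (fA s) (fB t)" if "s \<in> cS0 ?F" "t \<in> cT1 ?F" for s t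
      using that by (simp add: fm)
    \<comment> \<open>Here associativity enters: \<open>v s\<close> acts on T_1 as \<open>s\<close>
      followed by \<open>v\<close>, so both copies of S^0 act alike.\<close>
    show "actVT2 E v (fC (actS1T1 ?F s t)) = actS1T1 E (actVS0 E v (fA s)) (fB t)"
      if "s \<in> cS1 ?F" "t \<in> cT1 ?F" for s t
      using that v DA(5) DB(5) by (simp add: fm associative)
    show "actVS0 E v (fA (actVS0 ?F a s)) = actVS0 E (a *\<^sub>R v) (fA s)"
      if "a \<in> cV ?F" "s \<in> cS0 ?F" for a s
      using that v DA(5) by (simp add: VS.lin1 VS.lin2 lin_on_scale[OF DA(4) A.sub])
    show "actVT2 E v (fC (actVT2 ?F a s)) = actVT2 E (a *\<^sub>R v) (fC s)"
      if "a \<in> cV ?F" "s \<in> cT2 ?F" for a s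
      using that v DC(5) by (simp add: VT.lin1 VT.lin2 lin_on_scale[OF DC(4) C.sub])
  qed (auto simp: real_line_data_def pre_cliff_def A.sub B.sub C.sub clmod_pre_cliff[OF cl]
      clmod_pre_cliff[OF cl, unfolded pre_cliff_def])
  ultimately show ?thesis using cl by blast
qed

end

section \<open>Model extensions\<close>

text \<open>Treats C and H at once. \<open>cj_eq\<close> is the reflection that
  \<open>rot_adjoint\<close> dictates, \<open>mul_cj\<close> yields the Clifford relation of the
  model, and \<open>inner_right\<close> identifies its metric with the Euclidean one.\<close>

locale star_algebra =
  fixes mul :: "'a::euclidean_space \<Rightarrow> 'a \<Rightarrow> 'a" and cj :: "'a \<Rightarrow> 'a" and re :: "'a \<Rightarrow> real"
    and one :: 'a
  assumes mul_scale_left: "mul (r *\<^sub>R x) z = r *\<^sub>R mul x z"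
    and mul_scale_right: "mul x (r *\<^sub>R z) = r *\<^sub>R mul x z"
    and cj_eq: "cj x = (2 * (x \<bullet> one)) *\<^sub>R one - x"
    and re_eq: "re x = x \<bullet> one"
    and inner_one: "one \<bullet> one = 1"
    and mul_cj: "mul x (mul (cj x) z) = (x \<bullet> x) *\<^sub>R z"
    and inner_right: "mul x (cj y) \<bullet> one = x \<bullet> y"
    and inner_left: "mul (cj y) x \<bullet> one = x \<bullet> y"
begin

lemma mul_0: "mul x 0 = 0" "mul 0 x = 0" "cj 0 = 0"
  using mul_scale_right[of x 0 0] mul_scale_left[of 0 0 x] by (simp_all add: cj_eq)

lemma mul_minus: "mul x (- z) = - mul x z"
  using mul_scale_right[of x "-1" z] by simp

end

text \<open>\<open>psi\<close> identifies A with S^0, and \<open>rot_mul\<close> makes the resulting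
  endomorphisms of T_1 multiply like A. Producing such a \<open>psi\<close> is the work of each
  case; the passage to the model is common to both.\<close>

locale assoc_clifford_model = assoc_clifford E + star_algebra mul cj re one
  for E :: "('v::real_vector,'s::real_vector,'r::real_vector,'t::real_vector,'u::real_vector,'w::real_vector) cdata"
    and mul :: "'a::euclidean_space \<Rightarrow> 'a \<Rightarrow> 'a" and cj re one +
  fixes psi :: "'a \<Rightarrow> 's"
  assumes psi: "isometry UNIV (\<bullet>) (cS0 E) (gS0 E) psi"
    and rot_mul: "t \<in> cT1 E \<Longrightarrow> ST.rot (psi one) (psi (mul x y)) t
      = ST.rot (psi one) (psi x) (ST.rot (psi one) (psi y) t)"
begin

section \<open>T_1 as a module over the algebra\<close>

definition rho :: "'a \<Rightarrow> 't \<Rightarrow> 't" where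
  "rho x = ST.rot (psi one) (psi x)"

lemma psi_mem [simp]: "psi x \<in> cS0 E"
  using isometryD(5)[OF psi] by simp

lemma psi_inner: "gS0 E (psi x) (psi y) = x \<bullet> y"
  using isometryD(6)[OF psi] by simp

lemma unit: "psi one \<in> cS0 E" "gS0 E (psi one) (psi one) = 1"
  by (simp_all add: psi_inner inner_one)

lemma rho_mem [simp]: "t \<in> cT1 E \<Longrightarrow> rho x t \<in> cT1 E"
  by (simp add: rho_def ST.rot_mem[OF unit])

lemma act_rho: "t \<in> cT1 E \<Longrightarrow> actS0T1 E (psi one) (rho x t) = actS0T1 E (psi x) t"
  by (simp add: rho_def ST.act_rot[OF unit])

lemma rho_mul: "t \<in> cT1 E \<Longrightarrow> rho (mul x y) t = rho x (rho y t)"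
  by (simp add: rho_def rot_mul)

lemma rho_one: "t \<in> cT1 E \<Longrightarrow> rho one t = t"
  by (simp add: rho_def ST.rot_self[OF unit])

lemma rho_lin1: "t \<in> cT1 E \<Longrightarrow> lin_on UNIV (\<lambda>x. rho x t)"
  unfolding rho_def
  by (rule lin_on_comp[OF isometryD(4)[OF psi] _ ST.rot_lin1[OF unit]]) auto

lemma rho_lin2: "lin_on (cT1 E) (rho x)"
  unfolding rho_def by (rule ST.rot_lin2[OF unit]) simp

text \<open>\<open>rot_adjoint\<close> and \<open>cj_eq\<close> describe the same reflection, so
  conjugation in A becomes the adjoint on T_1.\<close>

lemma rho_adjoint:
  assumes "t \<in> cT1 E" "w \<in> cT1 E"
  shows "gT1 E (rho x t) w = gT1 E t (rho (cj x) w)"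
proof -
  have "rho (cj x) w = (2 * (x \<bullet> one)) *\<^sub>R w - rho x w"
    unfolding cj_eq using assms
    by (simp add: lin_on_diff[OF rho_lin1] lin_on_scale[OF rho_lin1] rho_one)
  moreover have "gT1 E (rho x t) w + gT1 E t (rho x w) = 2 * (one \<bullet> x) * gT1 E t w"
    using ST.rot_adjoint[OF unit, of "psi x"] assms by (simp add: rho_def psi_inner)
  ultimately show ?thesis
    using assms by (simp add: T1.right inner_commute)
qed

text \<open>Hence every single unit vector already meets the diagonal condition of a
  \<open>frame\<close>.\<close>

lemma rho_self:
  assumes "t \<in> cT1 E" shows "gT1 E (rho x t) t = (x \<bullet> one) * gT1 E t t"
  using ST.rot_adjoint[OF unit, of "psi x" t t] assms T1.sym[of "rho x t" t]
  by (simp add: psi_inner inner_commute flip: rho_def)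

text \<open>Orthonormality over A. The quantifier over \<open>x\<close> lets the real metric test
  all components of the A-valued inner product.\<close>

definition frame :: "nat \<Rightarrow> (nat \<Rightarrow> 't) \<Rightarrow> bool" where
  "frame n t \<longleftrightarrow> (\<forall>p<n. t p \<in> cT1 E) \<and>
    (\<forall>p<n. \<forall>q<n. \<forall>x. gT1 E (rho x (t p)) (t q) = (if p = q then x \<bullet> one else 0))"

lemma frame_inner:
  assumes "frame n t" "p < n" "q < n"
  shows "gT1 E (rho x (t p)) (rho y (t q)) = (if p = q then x \<bullet> y else 0)"
proof -
  have t: "t p \<in> cT1 E" "t q \<in> cT1 E" using assms by (auto simp: frame_def)
  have "gT1 E (rho x (t p)) (rho y (t q)) = gT1 E (rho y (t q)) (rho x (t p))"
    using t by (intro T1.sym) auto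
  also have "\<dots> = gT1 E (t q) (rho (mul (cj y) x) (t p))"
    using t by (simp add: rho_adjoint rho_mul)
  also have "\<dots> = gT1 E (rho (mul (cj y) x) (t p)) (t q)"
    using t by (intro T1.sym) auto
  also have "\<dots> = (if p = q then x \<bullet> y else 0)"
    using assms by (simp add: frame_def inner_left)
  finally show ?thesis .
qed

lemma frame_card:
  assumes "frame n t" shows "n \<le> dim (cT1 E)"
proof -
  have t: "t p \<in> cT1 E" if "p < n" for p using assms that by (auto simp: frame_def)
  have g: "gT1 E (t p) (t q) = (if p = q then 1 else 0)" if "p < n" "q < n" for p q
    using frame_inner[OF assms that, of one one] t that by (simp add: rho_one inner_one)
  have "inj_on t {..<n}"
  proof (rule inj_onI)
    fix p q assume "p \<in> {..<n}" "q \<in> {..<n}" "t p = t q"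
    then show "p = q" using g[of p p] g[of p q] by (auto split: if_splits)
  qed
  moreover have "orthonormal (gT1 E) (t ` {..<n})"
    unfolding orthonormal_def using g by auto (metis zero_neq_one)+
  ultimately show ?thesis
    using T1.orthonormal_card(2)[of "t ` {..<n}"] t by (auto simp: card_image)
qed

text \<open>Frames are bounded in length by \<open>frame_card\<close>, so a longest one exists. If
  its A-span were not all of T_1, a unit vector orthogonal to that span would prolong it.\<close>

lemma frame_exists:
  obtains n t where "frame n t"
    "cT1 E = span ((\<lambda>(b, p). rho b (t p)) ` (Basis \<times> {..<n}))"
proof -
  have "\<exists>n. (\<exists>t. frame n t) \<and> (\<forall>k. (\<exists>t. frame k t) \<longrightarrow> k \<le> n)"
  proof (rule ex_has_greatest_nat[of "\<lambda>n. \<exists>t. frame n t" 0 "\<lambda>n. n" "Suc (dim (cT1 E))"])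
    show "\<exists>t. frame 0 t" by (simp add: frame_def)
  qed (auto simp: less_Suc_eq_le frame_card)
  then obtain n t where F: "frame n t" and max: "\<And>k t'. frame k t' \<Longrightarrow> k \<le> n" by blast
  let ?B = "(\<lambda>(b, p). rho b (t p)) ` (Basis \<times> {..<n})"
  have t: "t p \<in> cT1 E" if "p < n" for p using F that by (auto simp: frame_def)
  have B: "?B \<subseteq> cT1 E" using t by auto
  have "orthonormal (gT1 E) ?B"
    unfolding orthonormal_def
  proof (intro ballI)
    fix y z assume "y \<in> ?B" "z \<in> ?B"
    then obtain b p c q where y: "b \<in> Basis" "p < n" "y = rho b (t p)"
      and z: "c \<in> Basis" "q < n" "z = rho c (t q)" by auto
    have yz: "gT1 E y z = (if b = c \<and> p = q then 1 else 0)"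
      using frame_inner[OF F y(2) z(2)] y z by (simp add: inner_Basis)
    \<comment> \<open>Vectors with different indices are orthogonal; being unit vectors, they are
      therefore also distinct.\<close>
    have "gT1 E y y = 1"
      using frame_inner[OF F y(2) y(2)] y by simp
    then show "gT1 E y z = (if y = z then 1 else 0)" using yz y z by (auto split: if_splits)
  qed
  moreover have "span ?B = cT1 E"
  proof (rule ccontr)
    assume "span ?B \<noteq> cT1 E"
    then have "\<not> cT1 E \<subseteq> span ?B" using span_minimal[OF B T1.sub] by auto
    then obtain s where s: "s \<in> cT1 E" "gT1 E s s = 1" "\<And>b. b \<in> ?B \<Longrightarrow> gT1 E s b = 0"
      using T1.orthonormal_extend[OF B \<open>orthonormal (gT1 E) ?B\<close>] by blast
    have 0: "gT1 E (rho x (t p)) s = 0" if p: "p < n" for x p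
    proof -
      have "rho x (t p) = rho (\<Sum>b\<in>Basis. (x \<bullet> b) *\<^sub>R b) (t p)"
        by (simp add: euclidean_representation)
      also have "\<dots> = (\<Sum>b\<in>Basis. (x \<bullet> b) *\<^sub>R rho b (t p))"
        using t[OF p] by (simp add: lin_on_sum[OF rho_lin1] lin_on_scale[OF rho_lin1])
      finally have "gT1 E s (rho x (t p)) = (\<Sum>b\<in>Basis. (x \<bullet> b) * gT1 E s (rho b (t p)))"
        using t[OF p] s(1) by (simp add: T1.sum_right T1.right)
      also have "\<dots> = 0" using s(3) p by (intro sum.neutral) auto
      finally show ?thesis using t[OF p] s(1) T1.sym[of s "rho x (t p)"] by simp
    qed
    \<comment> \<open>The multiples of the new vector are orthogonal to the old ones too: move
      \<open>x\<close> across as its conjugate.\<close>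
    have 1: "gT1 E (rho x s) (t p) = 0" if p: "p < n" for x p
      using 0[OF p, of "cj x"] t[OF p] s(1) T1.sym[of s "rho (cj x) (t p)"] by (simp add: rho_adjoint)
    have "frame (Suc n) (t(n := s))"
      using F s 0 1 unfolding frame_def by (auto simp: less_Suc_eq rho_self)
    then show False using max by fastforce
  qed
  ultimately show ?thesis using F that by metis
qed

text \<open>The map is c -> sum of c_p t_p for a maximal frame. It commutes with left multiplication
  by \<open>rho_mul\<close>, preserves the metric by \<open>frame_inner\<close>, and reaches the
  spanning vectors from tuples with one nonzero entry.\<close>

lemma module_isometry:
  obtains n f where "n \<ge> 1"
    and "isometry (An n :: (nat \<Rightarrow> 'a) set) (\<lambda>x y. re (\<Sum>i<n. mul (x i) (cj (y i)))) (cT1 E) (gT1 E) f"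
    and "\<And>x c. f (\<lambda>i. mul x (c i)) = rho x (f c)"
proof -
  obtain n t where F: "frame n t"
    and sp: "cT1 E = span ((\<lambda>(b, p). rho b (t p)) ` (Basis \<times> {..<n}))" by (rule frame_exists)
  have t: "t p \<in> cT1 E" if "p < n" for p using F that by (auto simp: frame_def)
  define f where "f c = (\<Sum>p<n. rho (c p) (t p))" for c
  have fT [simp]: "f c \<in> cT1 E" for c unfolding f_def using t by (intro T1.sum_closed) auto
  have "n \<ge> 1"
  proof (rule ccontr)
    assume "\<not> n \<ge> 1"
    then have "n = 0" by simp
    then have "cT1 E = {0}" using sp by simp
    then show False using T1_nz by simp
  qed
  moreover have lin: "lin_on UNIV f"
    unfolding lin_on_def f_def using t
    by (simp add: scaleR_fun_def lin_on_add[OF rho_lin1] lin_on_scale[OF rho_lin1]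
        sum.distrib scaleR_right.sum)
  have inner: "gT1 E (f c) (f d) = (\<Sum>p<n. c p \<bullet> d p)" for c d
  proof -
    have "gT1 E (f c) (f d) = (\<Sum>p<n. gT1 E (rho (c p) (t p)) (f d))"
      unfolding f_def[of c] using t by (intro T1.sum_left) auto
    also have "\<dots> = (\<Sum>p<n. \<Sum>q<n. gT1 E (rho (c p) (t p)) (rho (d q) (t q)))"
      unfolding f_def[of d] using t by (intro sum.cong refl T1.sum_right) auto
    also have "\<dots> = (\<Sum>p<n. \<Sum>q<n. if p = q then c p \<bullet> d q else 0)"
      by (intro sum.cong refl) (simp add: frame_inner[OF F])
    finally show ?thesis by simp
  qed
  have re: "re (\<Sum>i<n. mul (x i) (cj (y i))) = (\<Sum>i<n. x i \<bullet> y i)" for x y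
    by (simp add: re_eq inner_sum_left inner_right)
  have "isometry (An n) (\<lambda>x y. re (\<Sum>i<n. mul (x i) (cj (y i)))) (cT1 E) (gT1 E) f"
    unfolding re
  proof (rule isometryI)
    show lin': "lin_on (An n) f" using lin by (simp add: lin_on_def)
    show "x = 0" if "x \<in> An n" "(\<Sum>i<n. x i \<bullet> x i) = 0" for x :: "nat \<Rightarrow> 'a"
    proof
      fix i show "x i = 0 i"
        using that by (cases "i < n") (auto simp: An_def sum_nonneg_eq_0_iff)
    qed
    have "subspace (f ` An n)"
      by (rule lin_on_image_subspace[OF lin' subspace_An])
    moreover have "rho b (t p) \<in> f ` An n" if "p < n" for b p
    proof
      show "rho b (t p) = f (\<lambda>i. if i = p then b else 0)"
      proof -
        have "f (\<lambda>i. if i = p then b else 0) = (\<Sum>i<n. if i = p then rho b (t p) else 0)"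
          unfolding f_def using t lin_on_zero[OF rho_lin1] by (intro sum.cong refl) auto
        then show ?thesis using that by simp
      qed
      show "(\<lambda>i. if i = p then b else 0) \<in> An n" using that by (auto simp: An_def)
    qed
    ultimately have "cT1 E \<subseteq> f ` An n"
      unfolding sp by (intro span_minimal) auto
    then show "f ` An n = cT1 E" by auto
  qed (auto simp: subspace_An T1.left inner)
  moreover have "f (\<lambda>i. mul x (c i)) = rho x (f c)" for x c
    unfolding f_def using t by (subst lin_on_sum[OF rho_lin2 T1.sub]) (auto simp: rho_mul)
  ultimately show ?thesis by (rule that)
qed

text \<open>The intertwining identities on T_1 and T_2 follow from \<open>act_rho\<close> and
  associativity. The one on S^0 involves no vector of T_1 and is recovered from its effect
  there.\<close>

lemma model_iso:
  "\<exists>n\<ge>1. \<exists>W. subspace W \<and> W \<noteq> {0} \<and> dim W = dim (cV E) \<and>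
     cdata_iso E (model_ext mul cj re W n)"
proof -
  obtain v where v: "v \<in> cV E" "gV E v v = 1" by (rule unit_V)
  obtain n f where n: "n \<ge> 1"
    and f: "isometry (An n :: (nat \<Rightarrow> 'a) set) (\<lambda>x y. re (\<Sum>i<n. mul (x i) (cj (y i)))) (cT1 E) (gT1 E) f"
    and f_mul: "\<And>x c. f (\<lambda>i. mul x (c i)) = rho x (f c)"
    using module_isometry by blast
  have gA: "(\<lambda>x y. re (mul x (cj y))) = (\<bullet>)" by (simp add: fun_eq_iff re_eq inner_right)
  define Q where "Q x = actVS0 E v (psi x)" for x
  have Q: "isometry UNIV (\<bullet>) (cS1 E) (gS1 E) Q"
    using isometry_comp[OF psi VS.isometry_unit[OF v]] by (simp add: Q_def[abs_def])
  have Q': "isometry (cS1 E) (gS1 E) UNIV (\<bullet>) (inv Q)" by (rule isometry_inv[OF Q]) simp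
  \<comment> \<open>\<open>k w\<close> solves w s = v psi(q) for q, where s is
    \<open>psi one\<close>; this embeds V into A.\<close>
  define k where "k w = inv Q (actVS0 E w (psi one))" for w
  define W where "W = k ` cV E"
  have k: "isometry (cV E) (gV E) W (\<bullet>) k"
  proof (rule isometryI)
    show "lin_on (cV E) k"
      unfolding k_def by (rule lin_on_comp[OF VS.lins(1) _ isometryD(4)[OF Q']]) auto
    show "k x \<bullet> k y = gV E x y" if "x \<in> cV E" "y \<in> cV E" for x y
      using that unit by (simp add: k_def isometryD(6)[OF Q'] VS.inner_act_left)
  qed (auto simp: V.sub V.eq_0_iff W_def)
  have W: "subspace W" "dim W = dim (cV E)"
    using isometry_subspace[OF k V.sub] isometry_dim[OF k V.euclid] by auto
  have Wnz: "W \<noteq> {0}"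
  proof -
    have "k v \<bullet> k v = 1" "k v \<in> W" using isometryD(6)[OF k v(1) v(1)] v by (auto simp: W_def)
    then show ?thesis by auto
  qed
  define fV where "fV = inv_into (cV E) k"
  have fV: "isometry W (\<bullet>) (cV E) (gV E) fV"
    unfolding fV_def by (rule isometry_inv[OF k V.sub])
  have act_one: "actVS0 E (fV w) (psi one) = Q w" if "w \<in> W" for w
  proof -
    have "k (fV w) = w" using that by (auto simp: fV_def W_def intro: f_inv_into_f)
    moreover have "Q (k (fV w)) = actVS0 E (fV w) (psi one)"
      using isometryD(3)[OF Q] isometryD(5)[OF fV that] unfolding k_def
      by (intro f_inv_into_f) simp
    ultimately show ?thesis by simp
  qed
  have RT_Q: "actS1T1 E (Q x) t = actVT2 E v (actS0T1 E (psi one) (rho x t))"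
    if "t \<in> cT1 E" for x t
    using that v by (simp add: Q_def associative act_rho)
  \<comment> \<open>By associativity w(s t) = (w s)t, and w s is \<open>Q w\<close> by the choice of
    \<open>fV\<close>.\<close>
  have VT_fV: "actVT2 E (fV w) (actS0T1 E (psi one) t) = actVT2 E v (actS0T1 E (psi one) (rho w t))"
    if "w \<in> W" "t \<in> cT1 E" for w t
    using that isometryD(5)[OF fV] by (simp add: act_one RT_Q flip: associative)
  have Q_mem [simp]: "Q x \<in> cS1 E" for x using isometryD(5)[OF Q] by simp
  have VS_fV: "actVS0 E (fV w) (psi x) = Q (mul w x)" if w: "w \<in> W" for w x
  proof -
    \<comment> \<open>Two elements of S^1 that agree on one nonzero \<open>t\<close> are equal,
      since their difference would act injectively.\<close>
    obtain t where t: "t \<in> cT1 E" "t \<noteq> 0" using T1_nz T1.closed(1) by blast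
    have "actS1T1 E (actVS0 E (fV w) (psi x)) t = actVT2 E (fV w) (actS0T1 E (psi one) (rho x t))"
      using t isometryD(5)[OF fV w] by (simp add: associative act_rho)
    also have "\<dots> = actS1T1 E (Q (mul w x)) t"
      using t w by (simp add: VT_fV RT_Q rho_mul)
    finally have "actS1T1 E (actVS0 E (fV w) (psi x) - Q (mul w x)) t = 0"
      using t isometryD(5)[OF fV w] by (simp add: lin_on_diff[OF RT.lins(1) S1.sub])
    moreover have "actVS0 E (fV w) (psi x) - Q (mul w x) \<in> cS1 E"
      using isometryD(5)[OF fV w] by simp
    ultimately show ?thesis using RT.act_eq_0[OF _ t(1)] t(2) by fastforce
  qed
  note Df = isometryD[OF f]
  have f2: "isometry (An n :: (nat \<Rightarrow> 'a) set) (\<lambda>x y. re (\<Sum>i<n. mul (x i) (cj (y i)))) (cT2 E) (gT2 E)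
      (\<lambda>x. actS0T1 E (psi one) (f x))"
    by (rule isometry_comp[OF f ST.isometry_unit[OF unit]])
  have f3: "isometry (An n :: (nat \<Rightarrow> 'a) set) (\<lambda>x y. re (\<Sum>i<n. mul (x i) (cj (y i)))) (cT3 E) (gT3 E)
      (\<lambda>x. actVT2 E v (actS0T1 E (psi one) (f x)))"
    by (rule isometry_comp[OF f2 VT.isometry_unit[OF v]])
  have pre: "pre_cliff X (\<bullet>) UNIV UNIV mul (\<lambda>x z. - mul (cj x) z)"
    "pre_cliff X (\<bullet>) (An n) (An n) (\<lambda>x f i. mul x (f i)) (\<lambda>x f i. - mul (cj x) (f i))" for X
    by (auto simp: pre_cliff_def An_def mul_0 mul_minus mul_cj fun_eq_iff scaleR_fun_def fun_Compl_def)
  have "cdata_iso E (model_ext mul cj re W n)"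
    by (rule cdata_isoI[OF ext, where fV = fV and ?fS0.0 = psi and ?fS1.0 = Q and ?fT1.0 = f
        and ?fT2.0 = "\<lambda>x. actS0T1 E (psi one) (f x)"
        and ?fT3.0 = "\<lambda>x. actVT2 E v (actS0T1 E (psi one) (f x))"])
      (simp_all add: model_ext_def Let_def gA fV psi Q f f2 f3 W subspace_An pre VS_fV RT_Q VT_fV f_mul
        act_rho Df(5))
  then show ?thesis using n W Wnz by blast
qed

end

section \<open>The three cases\<close>

lemma star_algebra_complex: "star_algebra (*) cnj Re 1"
  by unfold_locales (auto simp: complex_eq_iff inner_complex_def algebra_simps power2_eq_square)

definition qone :: quat where
  "qone = vector [1, 0, 0, 0]"

lemma vector_4 [simp]:
  "(vector [a, b, c, d] :: 'a::zero ^ 4) $ 1 = a" "(vector [a, b, c, d] :: 'a ^ 4) $ 2 = b"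
  "(vector [a, b, c, d] :: 'a ^ 4) $ 3 = c" "(vector [a, b, c, d] :: 'a ^ 4) $ 4 = d"
  by (simp_all add: vector_def)

lemma quat_eq_iff: "p = q \<longleftrightarrow> p$1 = q$1 \<and> p$2 = q$2 \<and> p$3 = q$3 \<and> p$4 = q$4" for p q :: quat
  by (simp add: vec_eq_iff forall_4)

lemma quat_inner: "p \<bullet> q = p$1 * q$1 + p$2 * q$2 + p$3 * q$3 + p$4 * q$4" for p q :: quat
  by (simp add: inner_vec_def sum_4)

lemma star_algebra_quat: "star_algebra qmult qcnj qre qone"
  by unfold_locales
    (simp_all add: quat_eq_iff quat_inner qmult_def qcnj_def qre_def qone_def algebra_simps)

context cliff
begin

context
  fixes u assumes u: "u \<in> X" "gX u u = 1"
begin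

lemma rot_square:
  assumes "x \<in> X" "gX u x = 0" "gX x x = 1" "y \<in> Y"
  shows "rot u x (rot u x y) = - y"
proof -
  have "2 *\<^sub>R rot u x (rot u x y) = 2 *\<^sub>R (- y)"
    using rot_anticommute[OF u assms(1,1,2,2,4)] assms(3) by (simp add: scaleR_2)
  then show ?thesis by (rule scaleR_left_imp_eq[rotated]) simp
qed

lemma rot_anticommute_orth:
  assumes "x \<in> X" "w \<in> X" "gX u x = 0" "gX u w = 0" "gX x w = 0" "y \<in> Y"
  shows "rot u x (rot u w y) = - rot u w (rot u x y)"
  using rot_anticommute[OF u assms(1-4,6)] assms(5) by (simp add: eq_neg_iff_add_eq_0)

lemma rot_orth:
  assumes "x \<in> X" "gX u x = 0" "y \<in> Y" "w \<in> Y"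
  shows "gY (rot u x y) w = - gY y (rot u x w)" and "gY (rot u x y) y = 0" "gY y (rot u x y) = 0"
  using rot_adjoint[OF u assms(1,3,4)] rot_adjoint[OF u assms(1,3,3)] assms u
    Y.sym[of "rot u x y" y] by (simp_all add: rot_mem)

end

end

section \<open>The product rule, and the cases C and H\<close>

context assoc_clifford
begin

text \<open>By associativity, v^{-1}e applied to \<open>s\<close> acts on T_1 as \<open>s\<close>
  followed by the operator v^{-1}e on T_2. Transported to T_1 by \<open>u\<close>, that operator is
  the one of v^{-1}e applied to \<open>u\<close>. This makes k the product of i and j.\<close>

lemma ST_rot_VS_rot:
  assumes v: "v \<in> cV E" "gV E v v = 1" and e: "e \<in> cV E"
    and u: "u \<in> cS0 E" "gS0 E u u = 1" and s: "s \<in> cS0 E" and t: "t \<in> cT1 E"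
  shows "ST.rot u (VS.rot v e s) t = ST.rot u (VS.rot v e u) (ST.rot u s t)"
proof -
  have *: "actS0T1 E (VS.rot v e s) t = VT.rot v e (actS0T1 E s t)"
    if s: "s \<in> cS0 E" and t: "t \<in> cT1 E" for s t
  proof -
    have "actVT2 E v (actS0T1 E (VS.rot v e s) t) = actVT2 E e (actS0T1 E s t)"
      using s t v e by (simp add: VS.rot_mem VS.act_rot flip: associative)
    then have "VT.rot v e (actS0T1 E s t) = - actVT3 E v (actVT2 E v (actS0T1 E (VS.rot v e s) t))"
      by (simp add: VT.rot_def)
    then show ?thesis using s t v e by (simp add: VT.square VS.rot_mem)
  qed
  have "ST.rot u (VS.rot v e s) t = - actS0T2 E u (VT.rot v e (actS0T1 E s t))"
    using * s t by (simp add: ST.rot_def)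
  also have "\<dots> = - actS0T2 E u (VT.rot v e (actS0T1 E u (ST.rot u s t)))"
    using s t u by (simp add: ST.act_rot)
  also have "\<dots> = ST.rot u (VS.rot v e u) (ST.rot u s t)"
    using * s t u by (simp add: ST.rot_def)
  finally show ?thesis .
qed

lemma orthonormal_pairs:
  assumes "dim (cV E) > 1"
  obtains v e u where "v \<in> cV E" "gV E v v = 1" "e \<in> cV E" "gV E e e = 1" "gV E v e = 0"
    "u \<in> cS0 E" "gS0 E u u = 1"
proof -
  obtain v where v: "v \<in> cV E" "gV E v v = 1" by (rule unit_V)
  obtain e where e: "e \<in> cV E" "gV E e e = 1" "\<And>b. b \<in> {v} \<Longrightarrow> gV E e b = 0"
    using v assms by (auto intro: V.orthonormal_extend_dim[of "{v}"] simp: orthonormal_def)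
  obtain s where "s \<in> cS0 E" "s \<noteq> 0" by (rule S0_nz)
  then obtain r where "gS0 E (r *\<^sub>R s) (r *\<^sub>R s) = 1" by (rule S0.unit_multiple)
  then show ?thesis
    using that[of v e "r *\<^sub>R s"] v e V.sym[of e v] \<open>s \<in> cS0 E\<close> by simp
qed

lemma dim_S0_2:
  assumes "dim (cV E) > 1" "dim (cS0 E) = 2"
  shows "\<exists>n\<ge>1. cdata_iso E (model_C UNIV n)"
proof -
  obtain v e s where v: "v \<in> cV E" "gV E v v = 1" and e: "e \<in> cV E" "gV E e e = 1" "gV E v e = 0"
    and s: "s \<in> cS0 E" "gS0 E s s = 1"
    by (rule orthonormal_pairs[OF assms(1)])
  define i where "i = VS.rot v e s"
  have i: "i \<in> cS0 E" "gS0 E i i = 1" "gS0 E s i = 0" "gS0 E i s = 0"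
    using v e s VS.rot_orth(2,3)[OF v e(1,3) s(1) s(1)]
    by (simp_all add: i_def VS.rot_mem VS.rot_inner)
  have sp: "span {s, i} = cS0 E"
    using s i assms by (intro S0.orthonormal_spans) (auto simp: orthonormal_def card_insert_if)
  define psi where "psi z = Re z *\<^sub>R s + Im z *\<^sub>R i" for z
  have psi_one: "psi 1 = s" by (simp add: psi_def)
  interpret star_algebra "(*)" cnj Re "1 :: complex" by (rule star_algebra_complex)
  interpret assoc_clifford_model E "(*)" cnj Re 1 psi
  proof unfold_locales
    show "isometry UNIV (\<bullet>) (cS0 E) (gS0 E) psi"
    proof (rule isometryI)
      show "range psi = cS0 E"
      proof
        show "cS0 E \<subseteq> range psi"
        proof
          fix x assume "x \<in> cS0 E"
          then obtain a b where "x - a *\<^sub>R s - b *\<^sub>R i = 0"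
            by (auto simp: span_breakdown_eq simp flip: sp)
          then have "x = psi (Complex a b)" by (simp add: psi_def algebra_simps)
          then show "x \<in> range psi" by simp
        qed
      qed (use s i in \<open>auto simp: psi_def\<close>)
      show "lin_on UNIV psi" by (simp add: lin_on_def psi_def algebra_simps)
      show "x = 0" if "x \<bullet> x = 0" for x using that by simp
    qed (use s i in \<open>auto simp: psi_def inner_complex_def S0.left S0.right\<close>)
    fix x y :: complex and t assume t: "t \<in> cT1 E"
    have r: "ST.rot s (psi z) w = Re z *\<^sub>R w + Im z *\<^sub>R ST.rot s i w" if "w \<in> cT1 E" for z w
      using that s i ST.rot_lin1[OF s that]
      by (simp add: psi_def lin_on_add[OF ST.rot_lin1[OF s that]]
          lin_on_scale[OF ST.rot_lin1[OF s that] S0.sub] ST.rot_self)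
    note lin = ST.rot_lin2[OF s i(1)]
    show "ST.rot (psi 1) (psi (x * y)) t = ST.rot (psi 1) (psi x) (ST.rot (psi 1) (psi y) t)"
      using t s i unfolding psi_one
      by (simp add: r lin_on_add[OF lin] lin_on_scale[OF lin T1.sub] ST.rot_mem ST.rot_square algebra_simps)
  qed
  obtain n W where n: "n \<ge> 1" "subspace W" "dim W = dim (cV E)" "cdata_iso E (model_C W n)"
    using model_iso by blast
  \<comment> \<open>Having dimension at least 2, W fills C; the model therefore has no free subspace
    here.\<close>
  have "dim W \<ge> DIM(complex)" using assms n by simp
  then have "W = UNIV" using n(2) dim_eq_full[of W] dim_subset_UNIV[of W] span_eq_iff[of W] by auto
  then show ?thesis using n by blast
qed

text \<open>The dimension of S^0 has no assumed upper bound. Excluding a fifth orthonormal vector is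
  what makes \<open>psi\<close> onto.\<close>

lemma dim_S0_gt_2:
  assumes "dim (cV E) > 1" "dim (cS0 E) > 2"
  shows "\<exists>n\<ge>1. \<exists>W. subspace W \<and> W \<noteq> {0} \<and> dim W = dim (cV E) \<and> cdata_iso E (model_H W n)"
proof -
  obtain v e s where v: "v \<in> cV E" "gV E v v = 1" and e: "e \<in> cV E" "gV E e e = 1" "gV E v e = 0"
    and s: "s \<in> cS0 E" "gS0 E s s = 1"
    by (rule orthonormal_pairs[OF assms(1)])
  define i where "i = VS.rot v e s"
  have i: "i \<in> cS0 E" "gS0 E i i = 1" "gS0 E s i = 0" "gS0 E i s = 0"
    using v e s VS.rot_orth(2,3)[OF v e(1,3) s(1) s(1)]
    by (simp_all add: i_def VS.rot_mem VS.rot_inner)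
  obtain j where "j \<in> cS0 E" "gS0 E j j = 1" "\<And>b. b \<in> {s, i} \<Longrightarrow> gS0 E j b = 0"
    by (rule S0.orthonormal_extend_dim[of "{s, i}"])
      (use s i assms in \<open>auto simp: orthonormal_def card_insert_if\<close>)
  then have j: "j \<in> cS0 E" "gS0 E j j = 1" "gS0 E s j = 0" "gS0 E j s = 0"
      "gS0 E i j = 0" "gS0 E j i = 0"
    using s i S0.sym[of j s] S0.sym[of j i] by auto
  define k where "k = VS.rot v e j"
  \<comment> \<open>Writing e for v^{-1}e: <ej, s> = -<j, es> = -<j, i> = 0 by skewness, and <ej,
    es> = <j, s> = 0 because e is isometric.\<close>
  have k0: "k \<in> cS0 E" "gS0 E k k = 1" "gS0 E k s = 0" "gS0 E k i = 0" "gS0 E k j = 0"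
    using VS.rot_mem[OF v e(1) j(1)] VS.rot_inner[OF v e(1) j(1) j(1)] VS.rot_inner[OF v e(1) j(1) s(1)]
      VS.rot_orth[OF v e(1,3) j(1) s(1)] VS.rot_orth(2)[OF v e(1,3) j(1) j(1)] e(2) j
    unfolding k_def i_def by simp_all
  then have k: "gS0 E s k = 0" "gS0 E i k = 0" "gS0 E j k = 0"
    using s i j S0.sym[of k s] S0.sym[of k i] S0.sym[of k j] by auto
  define I J where "I = ST.rot s i" and "J = ST.rot s j"
  have K: "ST.rot s k t = I (J t)" if "t \<in> cT1 E" for t
    using ST_rot_VS_rot[OF v e(1) s j(1) that] by (simp add: I_def J_def i_def k_def)
  have IJ [simp]: "I t \<in> cT1 E" "J t \<in> cT1 E" "I (I t) = - t" "J (J t) = - t" "J (I t) = - I (J t)"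
    if "t \<in> cT1 E" for t
    using that s i j by (simp_all add: I_def J_def ST.rot_mem ST.rot_square ST.rot_anticommute_orth[of s j i])
  have linI: "lin_on (cT1 E) I" and linJ: "lin_on (cT1 E) J"
    using ST.rot_lin2[OF s] i j by (simp_all add: I_def J_def)
  note lins = lin_on_add[OF linI] lin_on_scale[OF linI T1.sub] lin_on_minus[OF linI T1.sub] lin_on_diff[OF linI T1.sub]
    lin_on_add[OF linJ] lin_on_scale[OF linJ T1.sub] lin_on_minus[OF linJ T1.sub] lin_on_diff[OF linJ T1.sub]
  let ?B = "{s, i, j, k}"
  have B: "?B \<subseteq> cS0 E" "orthonormal (gS0 E) ?B" "card ?B = 4"
    using s i j k0 k by (auto simp: orthonormal_def card_insert_if)
  have "dim (cS0 E) = 4"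
  proof (rule ccontr)
    assume "dim (cS0 E) \<noteq> 4"
    then have "card ?B < dim (cS0 E)" using S0.orthonormal_card(2)[OF B(1,2)] B(3) by simp
    then obtain l where l: "l \<in> cS0 E" "gS0 E l l = 1" "\<And>b. b \<in> ?B \<Longrightarrow> gS0 E l b = 0"
      using S0.orthonormal_extend_dim[OF B(1,2)] by blast
    obtain t where t: "t \<in> cT1 E" "t \<noteq> 0" using T1_nz T1.closed(1) by blast
    define L where "L = ST.rot s l"
    have sl: "gS0 E s l = 0" using l S0.sym[of s l] s by simp
    have L: "L w \<in> cT1 E" "L (I w) = - I (L w)" "L (J w) = - J (L w)"
        "L (ST.rot s k w) = - ST.rot s k (L w)"
      if "w \<in> cT1 E" for w
      using that s i j k0 k l sl
      by (simp_all add: L_def I_def J_def ST.rot_mem ST.rot_anticommute_orth[of s l])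
    text \<open>Anticommuting with both \<open>I\<close> and \<open>J\<close>, \<open>L\<close> commutes with their product, which is the
      action of \<open>k\<close>, with which it anticommutes.\<close>
    have "I (J (L t)) = - I (J (L t))"
      using L[of t] L(2)[of "J t"] t by (simp add: K lins)
    then have "I (J (L t)) = 0" by (simp add: eq_neg_iff_add_eq_0 flip: scaleR_2)
    then have "J (I (I (J (L t)))) = 0"
      using lin_on_zero[OF linI T1.sub] lin_on_zero[OF linJ T1.sub] by simp
    \<comment> \<open>\<open>I\<close> and \<open>J\<close> square to minus the identity, so the
      word above reduces to \<open>L t\<close>.\<close>
    then have "L t = 0" using t L by (simp add: lins)
    then have "L (L t) = 0" using lin_on_zero[OF ST.rot_lin2[OF s l(1)] T1.sub] by (simp add: L_def)
    then show False using ST.rot_square[OF s l(1) sl l(2) t(1)] t(2) by (simp add: L_def)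
  qed
  then have sp: "span ?B = cS0 E" using B by (intro S0.orthonormal_spans) auto
  define psi where "psi q = q$1 *\<^sub>R s + q$2 *\<^sub>R i + q$3 *\<^sub>R j + q$4 *\<^sub>R k" for q :: quat
  have psi_one: "psi qone = s" by (simp add: psi_def qone_def)
  interpret star_algebra qmult qcnj qre qone by (rule star_algebra_quat)
  interpret assoc_clifford_model E qmult qcnj qre qone psi
  proof unfold_locales
    show "isometry UNIV (\<bullet>) (cS0 E) (gS0 E) psi"
    proof (rule isometryI)
      show "range psi = cS0 E"
      proof
        show "cS0 E \<subseteq> range psi"
        proof
          fix x assume "x \<in> cS0 E"
          then obtain a b c d where "x - a *\<^sub>R s - b *\<^sub>R i - c *\<^sub>R j - d *\<^sub>R k = 0"
            by (auto simp: span_breakdown_eq simp flip: sp)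
          then have "x = psi (vector [a, b, c, d])" by (simp add: psi_def algebra_simps)
          then show "x \<in> range psi" by simp
        qed
      qed (use s i j k0 in \<open>auto simp: psi_def\<close>)
      show "lin_on UNIV psi" by (simp add: lin_on_def psi_def algebra_simps)
      show "x = 0" if "x \<bullet> x = 0" for x using that by simp
    qed (use s i j k0 k in \<open>auto simp: psi_def quat_inner S0.left S0.right\<close>)
    fix x y :: quat and t assume t: "t \<in> cT1 E"
    \<comment> \<open>With k replaced by \<open>I\<close> after \<open>J\<close>, the multiplication
      table of H reduces to the relations in \<open>IJ\<close>.\<close>
    have r: "ST.rot s (psi q) w = q$1 *\<^sub>R w + q$2 *\<^sub>R I w + q$3 *\<^sub>R J w + q$4 *\<^sub>R I (J w)"
      if "w \<in> cT1 E" for q w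
      using that s i j k0 K[OF that]
      by (simp add: psi_def lin_on_add[OF ST.rot_lin1[OF s that]]
          lin_on_scale[OF ST.rot_lin1[OF s that] S0.sub] ST.rot_self I_def J_def)
    show "ST.rot (psi qone) (psi (qmult x y)) t
        = ST.rot (psi qone) (psi x) (ST.rot (psi qone) (psi y) t)"
      using t unfolding psi_one
      by (simp add: r lins qmult_def algebra_simps)
  qed
  show ?thesis by (rule model_iso)
qed

end

theorem mainTheorem10:
  fixes E :: "('v::real_vector,'s::real_vector,'r::real_vector,'t::real_vector,'u::real_vector,'w::real_vector) cdata"
  assumes ext: "clifford_extension E"
    and assoc: "associative_ext E"
    and T1_nz: "cT1 E \<noteq> {0}"
  shows "(dim (cV E) = 1 \<longrightarrow>
            (\<exists>(Vt :: (nat \<Rightarrow> real) set) gVt (St0 :: (nat \<Rightarrow> real) set) g0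
               (St1 :: (nat \<Rightarrow> real) set) g1 m m'.
               Vt \<noteq> {0} \<and> clmod Vt gVt St0 g0 St1 g1 m m' \<and>
               cdata_iso E (real_line_data Vt gVt St0 g0 St1 g1 m m')))
       \<and> (dim (cV E) > 1 \<and> dim (cS0 E) = 2 \<longrightarrow>
            (\<exists>n\<ge>1. cdata_iso E (model_C UNIV n)))
       \<and> (dim (cV E) > 1 \<and> dim (cS0 E) > 2 \<longrightarrow>
            (\<exists>n\<ge>1. \<exists>W. subspace W \<and> W \<noteq> {0} \<and> dim W = dim (cV E) \<and>
               cdata_iso E (model_H W n)))"
proof -
  interpret assoc_clifford E by unfold_locales (fact ext assoc T1_nz)+
  show ?thesis using dim_V_1 dim_S0_2 dim_S0_gt_2 by blast
qed

end
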